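(* Assume each $f_i$ is differentiable with $\|\nabla f_i(x)-\nabla f_i(y)\|\le L\|x-y\|$ for all $x,y\in\mathbb{R}^d$. Let $\epsilon>0$ and run the SCSG algorithm with constant batch sizes $$b_j\equiv 1,\qquad B_j\equiv B=\min\left\{\frac{12\mathcal{H}^*}{\epsilon},\,n\right\},\qquad \eta_j\equiv\eta=\frac{1}{6LB^{2/3}},$$ where $B$ (rounded up to an integer) satisfies $B\ge 8$. Then $$\mathbb{E}\,C_{\mathrm{comp}}(\epsilon)=O\left(\left(\frac{\mathcal{H}^*}{\epsilon}\wedge n\right)+\frac{L\Delta_f}{\epsilon}\left(\frac{\mathcal{H}^*}{\epsilon}\wedge n\right)^{2/3}\right),$$ where the hidden constant is absolute.
   Context: Let $f(x)=\frac1n\sum_{i=1}^n f_i(x)$ on $\mathbb{R}^d$, $\|\cdot\|$ the Euclidean norm, $a\wedge b=\min\{a,b\}$, $0<L<\infty$, $f^*=\inf_x f(x)>-\infty$, $\Delta_f=f(\tilde{x}_0)-f^*$, and $\mathcal{H}^*=\sup_x \frac1n\sum_{i=1}^n\|\nabla f_i(x)-\nabla f(x)\|^2<\infty$. For $\mathcal{I}\subset\{1,\dots,n\}$ write $\nabla f_{\mathcal{I}}(x)=\frac{1}{|\mathcal{I}|}\sum_{i\in\mathcal{I}}\nabla f_i(x)$. $N\sim\mathrm{Geom}(\rho)$ means $P(N=k)=\rho^k(1-\rho)$, $k=0,1,2,\dots$. SCSG algorithm. Inputs: number of epochs $T$, deterministic initial iterate $\tilde{x}_0\in\mathbb{R}^d$,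 stepsizes $\eta_j>0$, batch sizes $B_j\in\{1,\dots,n\}$, mini-batch sizes $b_j\in\{1,\dots,n\}$. For $j=1,\dots,T$: sample $\mathcal{I}_j\subset\{1,\dots,n\}$ uniformly among subsets of size $B_j$; set $g_j=\nabla f_{\mathcal{I}_j}(\tilde{x}_{j-1})$ and $x^{(j)}_0=\tilde{x}_{j-1}$; draw $N_j\sim\mathrm{Geom}(B_j/(B_j+b_j))$; for $k=1,\dots,N_j$ sample $\tilde{\mathcal{I}}_{k-1}\subset\{1,\dots,n\}$ uniformly among subsets of size $b_j$, set $\nu^{(j)}_{k-1}=\nabla f_{\tilde{\mathcal{I}}_{k-1}}(x^{(j)}_{k-1})-\nabla f_{\tilde{\mathcal{I}}_{k-1}}(x^{(j)}_0)+g_j$ and $x^{(j)}_k=x^{(j)}_{k-1}-\eta_j\nu^{(j)}_{k-1}$; finally set $\tilde{x}_j=x^{(j)}_{N_j}$. All random draws are independent. The output $\tilde{x}_T^*$ is sampled (independently of everything else) from $(\tilde{x}_j)_{j=1}^T$ with $P(\tilde{x}_T^*=\tilde{x}_j)\propto \eta_jB_j/b_j$. Complexity. Computing $\nabla f_{\mathcal{I}}(x)$ costs $|\mathcal{I}|$ units, and epoch $j$ is charged $B_j+b_jN_j$ units (expected cost $2B_j$). Let $T(\epsilon)=\min\{T:\ \mathbb{E}\|\nabla f(\tilde{x}_{T'}^* )\|^2\le\epsilon\text{ for all }T'\ge T\}$. $C_{\mathrm{comp}}(\epsilon)$ is the cost of reaching an $\epsilon$-accurate solution, i.e. the total cost of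 the first $T(\epsilon)$ epochs, so $\mathbb{E}\,C_{\mathrm{comp}}(\epsilon)\le 2\sum_{j=1}^{T(\epsilon)}B_j$. *)

theory Defs
  imports "HOL-Probability.Probability"
begin

section \<open>Euclidean spaces of arbitrary dimension in one type\<close>

text \<open>
  The constant hidden in the complexity bound is absolute, in particular independent of the
  dimension, so the dimension has to be quantified inside the formula. For this reason
  Euclidean \<open>d\<close>-space is not represented by a type of its own but as the subspace
  \<open>Rd d\<close>, spanned by the first \<open>d\<close> unit vectors, of the inner product
  space of finitely supported real sequences. On \<open>Rd d\<close> the library notions
  \<^const>\<open>inner\<close> and \<^const>\<open>norm\<close> are the Euclidean ones (see
  \<open>inner_Rd\<close> and \<open>norm_Rd\<close>).
\<close>

typedef rseq = "{x :: nat \<Rightarrow> real. finite {i. x i \<noteq> 0}}"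
  morphisms coord Abs_rseq
  by (rule exI[of _ "\<lambda>_. 0"]) simp

lemma finite_supp: "finite {i. coord x i \<noteq> 0}"
  using coord[of x] by simp

lemma rseq_eqI: "(\<And>i. coord x i = coord y i) \<Longrightarrow> x = y"
  by (simp add: coord_inject[symmetric] fun_eq_iff)

lemma coord_Abs: "finite {i. x i \<noteq> 0} \<Longrightarrow> coord (Abs_rseq x) = x"
  by (simp add: Abs_rseq_inverse)

instantiation rseq :: real_vector
begin

definition "0 = Abs_rseq (\<lambda>_. 0)"
definition "x + y = Abs_rseq (\<lambda>i. coord x i + coord y i)"
definition "x - y = Abs_rseq (\<lambda>i. coord x i - coord y i)"
definition "- x = Abs_rseq (\<lambda>i. - coord x i)"
definition "r *\<^sub>R x = Abs_rseq (\<lambda>i. r * coord x i)"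

lemma coord_zero [simp]: "coord 0 i = 0"
  by (simp add: zero_rseq_def coord_Abs)

lemma coord_plus [simp]: "coord (x + y) i = coord x i + coord y i"
  unfolding plus_rseq_def
  by (subst coord_Abs, rule finite_subset[OF _ finite_UnI[OF finite_supp[of x] finite_supp[of y]]])
    auto

lemma coord_minus [simp]: "coord (x - y) i = coord x i - coord y i"
  unfolding minus_rseq_def
  by (subst coord_Abs, rule finite_subset[OF _ finite_UnI[OF finite_supp[of x] finite_supp[of y]]])
    auto

lemma coord_uminus [simp]: "coord (- x) i = - coord x i"
  unfolding uminus_rseq_def by (subst coord_Abs) (simp_all add: finite_supp)

lemma coord_scaleR [simp]: "coord (r *\<^sub>R x) i = r * coord x i"
  unfolding scaleR_rseq_def
  by (subst coord_Abs, rule finite_subset[OF _ finite_supp[of x]]) auto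

instance
  by standard (auto intro!: rseq_eqI simp: algebra_simps)

end

instantiation rseq :: real_inner
begin

definition inner_rseq :: "rseq \<Rightarrow> rseq \<Rightarrow> real"
  where "inner_rseq x y = (\<Sum>i | coord x i \<noteq> 0. coord x i * coord y i)"
definition norm_rseq :: "rseq \<Rightarrow> real"
  where "norm_rseq x = sqrt (inner x x)"
definition dist_rseq :: "rseq \<Rightarrow> rseq \<Rightarrow> real"
  where "dist_rseq x y = norm (x - y)"
definition sgn_rseq :: "rseq \<Rightarrow> rseq"
  where "sgn_rseq x = x /\<^sub>R norm x"
definition uniformity_rseq :: "(rseq \<times> rseq) filter"
  where "uniformity_rseq = (INF e\<in>{0<..}. principal {(x, y). dist x y < e})"
definition open_rseq :: "rseq set \<Rightarrow> bool"
  where "open_rseq U = (\<forall>x\<in>U. \<forall>\<^sub>F (x', y) in uniformity. x' = x \<longrightarrow> y \<in> U)"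

lemma inner_rseq_superset:
  assumes "finite A" "{i. coord x i \<noteq> 0} \<subseteq> A"
  shows "inner x y = (\<Sum>i\<in>A. coord x i * coord y i)"
  unfolding inner_rseq_def using assms by (intro sum.mono_neutral_left) auto

instance
proof
  fix x y z :: rseq and r :: real
  let ?A = "{i. coord x i \<noteq> 0} \<union> {i. coord y i \<noteq> 0} \<union> {i. coord z i \<noteq> 0}"
  have A: "finite ?A" by (simp add: finite_supp)
  have *: "inner u v = (\<Sum>i\<in>?A. coord u i * coord v i)"
    if "{i. coord u i \<noteq> 0} \<subseteq> ?A" for u v
    using inner_rseq_superset[OF A that] .
  show "inner x y = inner y x"
    by (subst (1 2) *) (auto simp: mult.commute)
  show "inner (x + y) z = inner x z + inner y z"
    by (subst (1 2 3) *) (auto simp: algebra_simps sum.distrib)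
  show "inner (r *\<^sub>R x) y = r * inner x y"
    by (subst (1 2) *) (auto simp: algebra_simps sum_distrib_left)
  show "0 \<le> inner x x"
    by (simp add: inner_rseq_def sum_nonneg)
  show "(inner x x = 0) = (x = 0)"
    by (auto simp: inner_rseq_def sum_nonneg_eq_0_iff finite_supp intro!: rseq_eqI)
qed (simp_all add: norm_rseq_def dist_rseq_def sgn_rseq_def uniformity_rseq_def open_rseq_def)

end

definition Rd :: "nat \<Rightarrow> rseq set"
  where "Rd d = {x. \<forall>i\<ge>d. coord x i = 0}"

lemma inner_Rd: "x \<in> Rd d \<Longrightarrow> inner x y = (\<Sum>i<d. coord x i * coord y i)"
  by (rule inner_rseq_superset) (auto simp: Rd_def not_le[symmetric])

lemma norm_Rd: "x \<in> Rd d \<Longrightarrow> norm x = sqrt (\<Sum>i<d. (coord x i)\<^sup>2)"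
  by (simp add: norm_eq_sqrt_inner inner_Rd power2_eq_square)

text \<open>
  Objective functions have type \<^typ>\<open>rseq \<Rightarrow> real\<close>, but only their restrictions to
  \<open>Rd d\<close> matter: differentiability and gradients are taken within \<open>Rd d\<close>.
\<close>

definition grad :: "nat \<Rightarrow> (rseq \<Rightarrow> real) \<Rightarrow> rseq \<Rightarrow> rseq"
  where "grad d h x =
    (THE g. g \<in> Rd d \<and> (h has_derivative (\<lambda>v. inner g v)) (at x within Rd d))"

lemma Rd_add: "x \<in> Rd d \<Longrightarrow> y \<in> Rd d \<Longrightarrow> x + y \<in> Rd d"
  and Rd_diff: "x \<in> Rd d \<Longrightarrow> y \<in> Rd d \<Longrightarrow> x - y \<in> Rd d"
  and Rd_scaleR: "x \<in> Rd d \<Longrightarrow> r *\<^sub>R x \<in> Rd d"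
  by (auto simp: Rd_def)

lemma gradient_unique:
  assumes x: "x \<in> Rd d" and g: "g \<in> Rd d" "g' \<in> Rd d"
    and D: "(h has_derivative (\<lambda>v. inner g v)) (at x within Rd d)"
      "(h has_derivative (\<lambda>v. inner g' v)) (at x within Rd d)"
  shows "g = g'"
proof -
  define w where "w = g - g'"
  define p where "p = (\<lambda>t::real. x + t *\<^sub>R w)"
  have w: "w \<in> Rd d" using g by (simp add: w_def Rd_diff)
  have p: "(p has_derivative (\<lambda>t. t *\<^sub>R w)) (at 0 within UNIV)"
    unfolding p_def by (auto intro!: derivative_eq_intros)
  have pU: "p ` UNIV \<subseteq> Rd d" using x w by (auto simp: p_def Rd_add Rd_scaleR)
  have p0: "p 0 = x" by (simp add: p_def)
  have *: "((\<lambda>t. h (p t)) has_derivative (\<lambda>t. inner k (t *\<^sub>R w))) (at 0)"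
    if "(h has_derivative (\<lambda>v. inner k v)) (at x within Rd d)" for k
    by (rule has_derivative_in_compose[OF p])
      (use has_derivative_subset[OF that pU] in \<open>simp add: p0\<close>)
  have "(\<lambda>t. inner g (t *\<^sub>R w)) = (\<lambda>t. inner g' (t *\<^sub>R w))"
    using has_derivative_unique[OF *[OF D(1)] *[OF D(2)]] .
  from fun_cong[OF this, of 1] have "inner w w = 0"
    unfolding w_def by (simp add: inner_diff_left)
  then show ?thesis by (simp add: w_def)
qed

lemma grad_eqI:
  assumes "x \<in> Rd d" "g \<in> Rd d" "(h has_derivative (\<lambda>v. inner g v)) (at x within Rd d)"
  shows "grad d h x = g"
  unfolding grad_def using assms gradient_unique by (intro the_equality) blast+

lemma grad_has_derivative:
  assumes x: "x \<in> Rd d" and h: "h differentiable (at x within Rd d)"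
  shows "grad d h x \<in> Rd d"
    and "(h has_derivative (\<lambda>v. inner (grad d h x) v)) (at x within Rd d)"
proof -
  obtain D where D: "(h has_derivative D) (at x within Rd d)"
    using h unfolding differentiable_def by blast
  interpret D: bounded_linear D using D by (rule has_derivative_bounded_linear)
  define e where "e = (\<lambda>i::nat. Abs_rseq (\<lambda>j. if j = i then 1 else 0))"
  have e: "coord (e i) j = (if j = i then 1 else 0)" for i j
    unfolding e_def by (subst coord_Abs) auto
  have sum: "coord (\<Sum>i\<in>A. u i) j = (\<Sum>i\<in>A. coord (u i) j)" for u and A :: "nat set" and j
    by (induction A rule: infinite_finite_induct) auto
  define g where "g = Abs_rseq (\<lambda>i. if i < d then D (e i) else 0)"
  have g: "coord g i = (if i < d then D (e i) else 0)" for i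
    unfolding g_def by (subst coord_Abs) (auto intro: finite_subset[of _ "{..<d}"])
  have gR: "g \<in> Rd d" by (simp add: Rd_def g)
  have Dg: "D v = inner g v" if v: "v \<in> Rd d" for v
  proof -
    have "v = (\<Sum>i<d. coord v i *\<^sub>R e i)"
    proof (rule rseq_eqI)
      fix j
      have "(\<Sum>i<d. coord v i * (if j = i then 1 else 0)) = (\<Sum>i<d. if i = j then coord v i else 0)"
        by (intro sum.cong) auto
      then show "coord v j = coord (\<Sum>i<d. coord v i *\<^sub>R e i) j"
        using v by (auto simp: sum e Rd_def)
    qed
    then have "D v = D (\<Sum>i<d. coord v i *\<^sub>R e i)" by simp
    also have "\<dots> = inner g v"
      by (simp add: D.sum D.scaleR inner_Rd[OF gR] g mult.commute)
    finally show ?thesis .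
  qed
  have eq: "inner g (y - x) = D (y - x)" if "y \<in> Rd d" for y
    using Dg[OF Rd_diff[OF that x]] by simp
  have "(h has_derivative (\<lambda>v. inner g v)) (at x within Rd d)"
    using D unfolding has_derivative_within
    by (auto simp: eq bounded_linear_inner_right cong: Lim_cong_within)
  then show "grad d h x \<in> Rd d"
    and "(h has_derivative (\<lambda>v. inner (grad d h x) v)) (at x within Rd d)"
    using grad_eqI[OF x gR] gR by auto
qed


section \<open>Finite sums\<close>

text \<open>The component functions are \<open>f 1, \<dots>, f n\<close>.\<close>

definition mean_fun :: "nat \<Rightarrow> (nat \<Rightarrow> rseq \<Rightarrow> real) \<Rightarrow> rseq \<Rightarrow> real"
  where "mean_fun n f x = (1 / real n) * (\<Sum>i=1..n. f i x)"

definition batch_grad :: "nat \<Rightarrow> (nat \<Rightarrow> rseq \<Rightarrow> real) \<Rightarrow> nat set \<Rightarrow> rseq \<Rightarrow> rseq"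
  where "batch_grad d f I x = (1 / real (card I)) *\<^sub>R (\<Sum>i\<in>I. grad d (f i) x)"

definition grad_variance :: "nat \<Rightarrow> nat \<Rightarrow> (nat \<Rightarrow> rseq \<Rightarrow> real) \<Rightarrow> rseq \<Rightarrow> real"
  where "grad_variance d n f x =
    (1 / real n) * (\<Sum>i=1..n. (norm (grad d (f i) x - grad d (mean_fun n f) x))\<^sup>2)"

definition H_star :: "nat \<Rightarrow> nat \<Rightarrow> (nat \<Rightarrow> rseq \<Rightarrow> real) \<Rightarrow> real"
  where "H_star d n f = (SUP x\<in>Rd d. grad_variance d n f x)"

definition Delta_f :: "nat \<Rightarrow> nat \<Rightarrow> (nat \<Rightarrow> rseq \<Rightarrow> real) \<Rightarrow> rseq \<Rightarrow> real"
  where "Delta_f d n f x0 = mean_fun n f x0 - (INF x\<in>Rd d. mean_fun n f x)"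


section \<open>The SCSG algorithm\<close>

definition sample_batch :: "nat \<Rightarrow> nat \<Rightarrow> nat set pmf"
  where "sample_batch n m = pmf_of_set {I. I \<subseteq> {1..n} \<and> card I = m}"

text \<open>
  \<open>Geom \<rho>\<close> assigns the probability \<open>\<rho> ^ k * (1 - \<rho>)\<close> to \<open>k\<close>; the parameter of the
  library distribution is the success probability \<open>1 - \<rho>\<close>.
\<close>

definition Geom :: "real \<Rightarrow> nat pmf"
  where "Geom \<rho> = geometric_pmf (1 - \<rho>)"

text \<open>Law of the \<open>k\<close>-th inner iterate of an epoch that starts at \<open>x\<close> with anchor gradient \<open>g\<close>.\<close>

primrec inner_iter :: "nat \<Rightarrow> nat \<Rightarrow> (nat \<Rightarrow> rseq \<Rightarrow> real) \<Rightarrow> real \<Rightarrow> nat \<Rightarrow> rseq \<Rightarrow> rseq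
    \<Rightarrow> nat \<Rightarrow> rseq pmf"
where
  "inner_iter d n f \<eta> b x g 0 = return_pmf x"
| "inner_iter d n f \<eta> b x g (Suc k) = do {
     y \<leftarrow> inner_iter d n f \<eta> b x g k;
     I \<leftarrow> sample_batch n b;
     let \<nu> = batch_grad d f I y - batch_grad d f I x + g;
     return_pmf (y - \<eta> *\<^sub>R \<nu>)
   }"

text \<open>One epoch started at \<open>x\<close>; the result pairs the next iterate with the number of inner steps.\<close>

definition epoch :: "nat \<Rightarrow> nat \<Rightarrow> (nat \<Rightarrow> rseq \<Rightarrow> real) \<Rightarrow> real \<Rightarrow> nat \<Rightarrow> nat \<Rightarrow> rseq
    \<Rightarrow> (rseq \<times> nat) pmf"
where
  "epoch d n f \<eta> B b x = do {
     I \<leftarrow> sample_batch n B;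
     let g = batch_grad d f I x;
     N \<leftarrow> Geom (real B / (real B + real b));
     y \<leftarrow> inner_iter d n f \<eta> b x g N;
     return_pmf (y, N)
   }"

text \<open>
  Joint law of the list of the iterates number \<open>0, \<dots>, T\<close> and of the accumulated cost.
  In the schedules \<open>\<eta>\<close>, \<open>B\<close>, \<open>b\<close> the epochs are numbered from \<open>1\<close>.
\<close>

primrec scsg_run :: "nat \<Rightarrow> nat \<Rightarrow> (nat \<Rightarrow> rseq \<Rightarrow> real) \<Rightarrow> rseq \<Rightarrow> (nat \<Rightarrow> real) \<Rightarrow> (nat \<Rightarrow> nat)
    \<Rightarrow> (nat \<Rightarrow> nat) \<Rightarrow> nat \<Rightarrow> (rseq list \<times> nat) pmf"
where
  "scsg_run d n f x0 \<eta> B b 0 = return_pmf ([x0], 0)"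
| "scsg_run d n f x0 \<eta> B b (Suc j) = do {
     (xs, c) \<leftarrow> scsg_run d n f x0 \<eta> B b j;
     (y, N) \<leftarrow> epoch d n f (\<eta> (Suc j)) (B (Suc j)) (b (Suc j)) (last xs);
     return_pmf (xs @ [y], c + B (Suc j) + b (Suc j) * N)
   }"

definition output_index :: "(nat \<Rightarrow> real) \<Rightarrow> (nat \<Rightarrow> nat) \<Rightarrow> (nat \<Rightarrow> nat) \<Rightarrow> nat \<Rightarrow> nat pmf"
  where "output_index \<eta> B b T =
    (let w = (\<lambda>j. \<eta> j * real (B j) / real (b j))
     in embed_pmf (\<lambda>j. if j \<in> {1..T} then w j / (\<Sum>i=1..T. w i) else 0))"

lemma pmf_output_index:
  assumes "T \<ge> 1" "\<And>j. j \<in> {1..T} \<Longrightarrow> \<eta> j > 0 \<and> B j > 0 \<and> b j > 0"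
  shows "pmf (output_index \<eta> B b T) j = (if j \<in> {1..T}
    then (\<eta> j * real (B j) / real (b j)) / (\<Sum>i=1..T. \<eta> i * real (B i) / real (b i)) else 0)"
proof -
  define w where "w = (\<lambda>j. \<eta> j * real (B j) / real (b j))"
  define q where "q = (\<lambda>j. if j \<in> {1..T} then w j / (\<Sum>i=1..T. w i) else 0)"
  have w: "w i > 0" if "i \<in> {1..T}" for i using assms(2)[OF that] by (simp add: w_def)
  have W: "(\<Sum>i=1..T. w i) > 0" using assms(1) w by (intro sum_pos) auto
  have q: "q i \<ge> 0" for i using w[of i] W by (auto simp: q_def)
  have "(\<integral>\<^sup>+ i. ennreal (q i) \<partial>count_space UNIV) = (\<Sum>i=1..T. ennreal (q i))"
    by (rule nn_integral_count_space'[of "{1..T}"]) (auto simp: q_def)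
  also have "\<dots> = ennreal (\<Sum>i=1..T. q i)" using q by (intro sum_ennreal) auto
  also have "(\<Sum>i=1..T. q i) = 1"
    using W by (simp add: q_def sum_divide_distrib[symmetric])
  finally have "pmf (embed_pmf q) j = q j" using q by (intro pmf_embed_pmf) auto
  then show ?thesis unfolding output_index_def Let_def q_def w_def .
qed

definition scsg_output :: "nat \<Rightarrow> nat \<Rightarrow> (nat \<Rightarrow> rseq \<Rightarrow> real) \<Rightarrow> rseq \<Rightarrow> (nat \<Rightarrow> real)
    \<Rightarrow> (nat \<Rightarrow> nat) \<Rightarrow> (nat \<Rightarrow> nat) \<Rightarrow> nat \<Rightarrow> rseq pmf"
where
  "scsg_output d n f x0 \<eta> B b T = do {
     (xs, c) \<leftarrow> scsg_run d n f x0 \<eta> B b T;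
     j \<leftarrow> output_index \<eta> B b T;
     return_pmf (xs ! j)
   }"

text \<open>
  Expectations are integrals with values in \<^typ>\<open>ennreal\<close>, so that an infinite expectation is
  not mistaken for \<open>0\<close>. Likewise the number of epochs is \<open>\<infinity>\<close>, the infimum of the empty set,
  if the accuracy is never reached, and then the expected cost is \<open>\<infinity>\<close>.
\<close>

definition mean_sq_grad :: "nat \<Rightarrow> nat \<Rightarrow> (nat \<Rightarrow> rseq \<Rightarrow> real) \<Rightarrow> rseq \<Rightarrow> (nat \<Rightarrow> real)
    \<Rightarrow> (nat \<Rightarrow> nat) \<Rightarrow> (nat \<Rightarrow> nat) \<Rightarrow> nat \<Rightarrow> ennreal"
where
  "mean_sq_grad d n f x0 \<eta> B b T =
    (\<integral>\<^sup>+ x. ennreal ((norm (grad d (mean_fun n f) x))\<^sup>2)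
      \<partial>measure_pmf (scsg_output d n f x0 \<eta> B b T))"

definition epochs_needed :: "nat \<Rightarrow> nat \<Rightarrow> (nat \<Rightarrow> rseq \<Rightarrow> real) \<Rightarrow> rseq \<Rightarrow> (nat \<Rightarrow> real)
    \<Rightarrow> (nat \<Rightarrow> nat) \<Rightarrow> (nat \<Rightarrow> nat) \<Rightarrow> real \<Rightarrow> enat"
where
  "epochs_needed d n f x0 \<eta> B b \<epsilon> =
    Inf {enat T | T. T \<ge> 1 \<and> (\<forall>T'\<ge>T. mean_sq_grad d n f x0 \<eta> B b T' \<le> ennreal \<epsilon>)}"

definition expected_C_comp :: "nat \<Rightarrow> nat \<Rightarrow> (nat \<Rightarrow> rseq \<Rightarrow> real) \<Rightarrow> rseq \<Rightarrow> (nat \<Rightarrow> real)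
    \<Rightarrow> (nat \<Rightarrow> nat) \<Rightarrow> (nat \<Rightarrow> nat) \<Rightarrow> real \<Rightarrow> ennreal"
where
  "expected_C_comp d n f x0 \<eta> B b \<epsilon> =
    (case epochs_needed d n f x0 \<eta> B b \<epsilon> of
       enat T \<Rightarrow> (\<integral>\<^sup>+ (xs, c). ennreal (real c) \<partial>measure_pmf (scsg_run d n f x0 \<eta> B b T))
     | \<infinity> \<Rightarrow> \<infinity>)"

end

theory Submission
  imports Defs
begin

text \<open>
  Write \<open>h\<close> for the step size, \<open>p = 1 / B\<close>, \<open>F = f - f\<^sup>*\<close>, and fix an epoch that starts at
  \<open>x\<close> with anchor gradient \<open>g\<close>; let \<open>e = g - \<nabla>f(x)\<close>. An inner step moves \<open>y\<close> to
  \<open>y - h \<nu>\<close>, where \<open>\<nu>\<close> has mean \<open>\<nabla>f(y) + e\<close> and variance at most \<open>L\<^sup>2 |y - x|\<^sup>2\<close>. Two effects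
  have to be controlled: the bias \<open>e\<close>, which is the same in all steps of the epoch, and the growth of
  the variance with the distance to \<open>x\<close>. Both are absorbed by the potential
  \[ \Psi(y) = F(y) + \frac{p}{2h} \, |y - x - (h/p)\, e|^2 . \]
  Its weight and its centre are chosen such that, when one compares \<open>E \<Psi>(y - h \<nu>)\<close> with
  \<open>(1 + p) \<Psi>(y)\<close>, the terms \<open>\<langle>e, \<nabla>f(y)\<rangle>\<close> and \<open>\<langle>e, y - x\<rangle>\<close> cancel. The quadratic
  terms that remain have the right sign if \<open>h L\<close> is at most a small constant times \<open>p\<close> to the power
  \<open>2/3\<close>, and one obtains (\<open>potential_inner_step\<close>)
  \[ E \Psi(y - h \nu) + \frac{h}{4} |\nabla f(y)|^2 + p F(y) \le (1 + p) \Psi(y) + h |e|^2 . \]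

  The factor \<open>1 + p\<close> is exactly the ratio of consecutive weights of the geometric number of inner
  steps, so the weighted sum of these inequalities telescopes
  (\<open>geometric_expectation_le_of_recursion\<close>). Since \<open>\<Psi>\<close> is nonnegative, the boundary term can be
  dropped, and no integrability of the iterates has to be known beforehand. The value
  \<open>\<Psi>(x) = F(x) + h |e|\<^sup>2 / (2 p)\<close> turns the result into
  \[ E \Big[ \frac{h}{4} |\nabla f(\tilde x)|^2 + p F(\tilde x) \Big] \le p F(x) + \frac{3}{2} h |e|^2 \]
  for the end point of the epoch. Sampling without replacement gives \<open>E |e|\<^sup>2 \<le> H\<^sup>* / B\<close>, and
  \<open>e = 0\<close> if \<open>B = n\<close> (\<open>batch_grad_error\<close>).

  Summing over \<open>T\<close> epochs, the values of \<open>F\<close> telescope and the uniformly chosen output has mean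
  squared gradient at most \<open>4 \<Delta> / (B h T)\<close>, plus \<open>6 H\<^sup>* / B\<close> if \<open>B < n\<close>
  (\<open>mean_sq_grad_le\<close>). In that case \<open>B \<ge> 12 H\<^sup>* / \<epsilon>\<close>, so the second term is at most
  \<open>\<epsilon> / 2\<close>. With \<open>h = 1 / (6 L s\<^sup>2)\<close>, where \<open>s\<close> is the cube root of \<open>B\<close>, the first one is \<open>24 L \<Delta> / (s T)\<close>, hence at most \<open>\<epsilon> / 2\<close> from
  \<open>T = 48 L \<Delta> / (\<epsilon> s)\<close> on. Each epoch costs \<open>2 B\<close> on average, which gives the bound.
\<close>

section \<open>Sampling without replacement\<close>

lemma sum_norm_diff_mean_sq:
  fixes a :: "'i \<Rightarrow> 'a::real_inner"
  assumes c: "c = (1 / real (card S)) *\<^sub>R (\<Sum>i\<in>S. a i)" and S: "finite S" "S \<noteq> {}"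
  shows "(\<Sum>i\<in>S. (norm (a i - c))\<^sup>2) = (\<Sum>i\<in>S. (norm (a i))\<^sup>2) - real (card S) * (norm c)\<^sup>2"
proof -
  have s: "(\<Sum>i\<in>S. a i) = real (card S) *\<^sub>R c" using S by (simp add: c)
  have "(\<Sum>i\<in>S. (norm (a i - c))\<^sup>2)
      = (\<Sum>i\<in>S. (norm (a i))\<^sup>2 - 2 * inner (a i) c + (norm c)\<^sup>2)"
    by (intro sum.cong refl)
      (simp add: power2_norm_eq_inner inner_diff_left inner_diff_right inner_commute)
  also have "\<dots> = (\<Sum>i\<in>S. (norm (a i))\<^sup>2) - 2 * inner (\<Sum>i\<in>S. a i) c
      + real (card S) * (norm c)\<^sup>2"
    by (simp add: sum.distrib sum_subtractf inner_sum_left sum_distrib_left)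
  finally have "(\<Sum>i\<in>S. (norm (a i - c))\<^sup>2)
      = (\<Sum>i\<in>S. (norm (a i))\<^sup>2) - 2 * inner (\<Sum>i\<in>S. a i) c + real (card S) * (norm c)\<^sup>2" .
  then show ?thesis unfolding s by (simp add: power2_norm_eq_inner)
qed

lemma card_subsets_containing:
  assumes "finite S" "C \<subseteq> S"
  shows "card {I. I \<subseteq> S \<and> card I = m + card C \<and> C \<subseteq> I} = (card S - card C) choose m"
proof -
  have fC: "finite C" using assms finite_subset by blast
  have "bij_betw (\<lambda>J. J \<union> C) {J. J \<subseteq> S - C \<and> card J = m}
      {I. I \<subseteq> S \<and> card I = m + card C \<and> C \<subseteq> I}"
  proof (rule bij_betw_byWitness[where f' = "\<lambda>I. I - C"])
    show "(\<lambda>J. J \<union> C) ` {J. J \<subseteq> S - C \<and> card J = m}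
        \<subseteq> {I. I \<subseteq> S \<and> card I = m + card C \<and> C \<subseteq> I}"
    proof (clarsimp, intro conjI)
      fix J assume J: "J \<subseteq> S - C"
      then show "J \<subseteq> S" by blast
      show "C \<subseteq> S" by fact
      have "finite J" using J assms(1) by (meson finite_Diff finite_subset)
      then show "card (J \<union> C) = card J + card C"
        using J fC by (intro card_Un_disjoint) auto
    qed
    show "(\<lambda>I. I - C) ` {I. I \<subseteq> S \<and> card I = m + card C \<and> C \<subseteq> I}
        \<subseteq> {J. J \<subseteq> S - C \<and> card J = m}"
      using fC by (auto simp: card_Diff_subset)
    show "\<forall>J\<in>{J. J \<subseteq> S - C \<and> card J = m}. (J \<union> C) - C = J" by blast
    show "\<forall>I\<in>{I. I \<subseteq> S \<and> card I = m + card C \<and> C \<subseteq> I}. (I - C) \<union> C = I" by blast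
  qed
  from bij_betw_same_card[OF this]
  have "card {I. I \<subseteq> S \<and> card I = m + card C \<and> C \<subseteq> I} = card {J. J \<subseteq> S - C \<and> card J = m}"
    by (rule sym)
  also have "\<dots> = (card S - card C) choose m"
    using assms fC by (simp add: n_subsets card_Diff_subset)
  finally show ?thesis .
qed

text \<open>
  Expand the square. Every pair of distinct indices lies in the same number \<open>c2\<close> of batches, so the
  cross terms sum to \<open>c2\<close> times the squared norm of the total, which vanishes, minus the
  diagonal. So they contribute nothing positive, and only the diagonal matters, in which each index is
  counted once for every batch that contains it.
\<close>

lemma sum_batches_norm_sq_le:
  fixes a :: "'i \<Rightarrow> 'a::real_inner"
  assumes S: "finite S" and a0: "(\<Sum>i\<in>S. a i) = 0" and m: "1 \<le> m"
  shows "(\<Sum>I | I \<subseteq> S \<and> card I = m. (norm (\<Sum>i\<in>I. a i))\<^sup>2)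
    \<le> real ((card S - 1) choose (m - 1)) * (\<Sum>i\<in>S. (norm (a i))\<^sup>2)"
proof -
  define P where "P = {I. I \<subseteq> S \<and> card I = m}"
  define c2 where "c2 = (if m \<ge> 2 then real ((card S - 2) choose (m - 2)) else 0)"
  have fP: "finite P" using S by (simp add: P_def)
  have c1: "card {I\<in>P. i \<in> I} = (card S - 1) choose (m - 1)" if "i \<in> S" for i
    using card_subsets_containing[of S "{i}" "m - 1"] that S m
    by (simp add: P_def conj_assoc)
  have c2: "real (card {I\<in>P. i \<in> I \<and> j \<in> I}) = c2" if "i \<in> S" "j \<in> S" "i \<noteq> j" for i j
  proof (cases "m \<ge> 2")
    case True
    then have "m - 2 + card {i, j} = m" "card {i, j} = 2" using that by auto
    with card_subsets_containing[of S "{i,j}" "m - 2"] that S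
    have "card {I. I \<subseteq> S \<and> card I = m \<and> {i, j} \<subseteq> I} = (card S - 2) choose (m - 2)"
      by simp
    then show ?thesis using True by (simp add: P_def conj_assoc c2_def)
  next
    case False
    then have "m = 1" using m by simp
    then have "{I\<in>P. i \<in> I \<and> j \<in> I} = {}"
      using that by (auto simp: P_def card_1_singleton_iff)
    then show ?thesis unfolding c2_def using False by (simp only: card.empty if_False of_nat_0)
  qed
  have sq: "inner (\<Sum>i\<in>I. a i) (\<Sum>j\<in>I. a j) = (\<Sum>i\<in>I. \<Sum>j\<in>I. inner (a i) (a j))" for I
    by (simp only: inner_sum_left) (simp only: inner_sum_right)
  have "(\<Sum>I\<in>P. (norm (\<Sum>i\<in>I. a i))\<^sup>2)
      = (\<Sum>I\<in>P. \<Sum>i\<in>S. \<Sum>j\<in>S. if i \<in> I \<and> j \<in> I then inner (a i) (a j) else 0)"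
  proof (intro sum.cong refl)
    fix I assume "I \<in> P"
    then have I: "I \<subseteq> S" by (simp add: P_def)
    have "(norm (\<Sum>i\<in>I. a i))\<^sup>2 = (\<Sum>i\<in>I. \<Sum>j\<in>I. inner (a i) (a j))"
      by (simp only: power2_norm_eq_inner sq)
    also have "\<dots> = (\<Sum>i\<in>I. \<Sum>j\<in>S. if i \<in> I \<and> j \<in> I then inner (a i) (a j) else 0)"
      using I S by (intro sum.cong[OF refl], intro sum.mono_neutral_cong_left) auto
    also have "\<dots> = (\<Sum>i\<in>S. \<Sum>j\<in>S. if i \<in> I \<and> j \<in> I then inner (a i) (a j) else 0)"
      using I S by (intro sum.mono_neutral_left) auto
    finally show "(norm (\<Sum>i\<in>I. a i))\<^sup>2
        = (\<Sum>i\<in>S. \<Sum>j\<in>S. if i \<in> I \<and> j \<in> I then inner (a i) (a j) else 0)" .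
  qed
  also have "\<dots> = (\<Sum>i\<in>S. \<Sum>j\<in>S. \<Sum>I\<in>P. if i \<in> I \<and> j \<in> I then inner (a i) (a j) else 0)"
    by (subst sum.swap, rule sum.cong[OF refl], rule sum.swap)
  also have "\<dots> = (\<Sum>i\<in>S. \<Sum>j\<in>S. real (card {I\<in>P. i \<in> I \<and> j \<in> I}) * inner (a i) (a j))"
    using fP by (intro sum.cong refl) (simp add: sum.If_cases Int_def)
  also have "\<dots> = (\<Sum>i\<in>S. \<Sum>j\<in>S. c2 * inner (a i) (a j)
      + (if j = i then (real ((card S - 1) choose (m - 1)) - c2) * (norm (a i))\<^sup>2 else 0))"
    by (intro sum.cong refl) (auto simp: c1 c2 power2_norm_eq_inner algebra_simps)
  also have "\<dots> = c2 * inner (\<Sum>i\<in>S. a i) (\<Sum>j\<in>S. a j)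
      + (real ((card S - 1) choose (m - 1)) - c2) * (\<Sum>i\<in>S. (norm (a i))\<^sup>2)"
    using S by (simp add: sum.distrib sq sum_distrib_left)
  also have "\<dots> \<le> real ((card S - 1) choose (m - 1)) * (\<Sum>i\<in>S. (norm (a i))\<^sup>2)"
    unfolding a0 by (simp add: mult_right_mono sum_nonneg c2_def)
  finally show ?thesis by (simp add: P_def)
qed

lemma set_pmf_sample_batch:
  assumes "m \<le> n"
  shows "set_pmf (sample_batch n m) = {I. I \<subseteq> {1..n} \<and> card I = m}"
proof -
  have "card {I. I \<subseteq> {1..n} \<and> card I = m} > 0" using assms by (simp add: n_subsets)
  then show ?thesis unfolding sample_batch_def by (intro set_pmf_of_set) (auto simp: card_gt_0_iff)
qed

text \<open>
  The identity between \<open>m * (n choose m)\<close> and \<open>n * ((n - 1) choose (m - 1))\<close> turns the number of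
  batches that contain a given index into the variance of the mean of \<open>m\<close> independent draws. That
  bound is crude for \<open>m = n\<close>, where the only batch is \<open>{1..n}\<close> and the mean vanishes.
\<close>

lemma mean_batch_norm_sq_le:
  fixes a :: "nat \<Rightarrow> 'a::real_inner"
  assumes a0: "(\<Sum>i=1..n. a i) = 0" and m: "1 \<le> m" "m \<le> n"
  shows "(\<integral>\<^sup>+ I. ennreal ((norm ((1 / real m) *\<^sub>R (\<Sum>i\<in>I. a i)))\<^sup>2) \<partial>sample_batch n m)
    \<le> ennreal (if m < n then (1 / real n) * (\<Sum>i=1..n. (norm (a i))\<^sup>2) / real m else 0)"
proof -
  define P where "P = {I. I \<subseteq> {1..n} \<and> card I = m}"
  have cP: "card P = n choose m" unfolding P_def by (simp add: n_subsets)
  have fP: "finite P" by (simp add: P_def)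
  have chp: "n choose m > 0" using m by simp
  have neP: "P \<noteq> {}" using cP chp by auto
  have eq: "(\<integral>\<^sup>+ I. ennreal ((norm ((1 / real m) *\<^sub>R (\<Sum>i\<in>I. a i)))\<^sup>2) \<partial>sample_batch n m)
      = ennreal ((\<Sum>I\<in>P. (norm (\<Sum>i\<in>I. a i))\<^sup>2) / (real m)\<^sup>2 / real (n choose m))"
    unfolding sample_batch_def P_def[symmetric] nn_integral_pmf_of_set[OF neP fP] cP using chp
    by (simp add: sum_nonneg sum_ennreal ennreal_of_nat_eq_real_of_nat divide_ennreal
        power_mult_distrib power_divide sum_divide_distrib)
  show ?thesis
  proof (cases "m < n")
    case True
    have ch: "real m * real (n choose m) = real n * real ((n - 1) choose (m - 1))"
      using binomial_absorption[of "m - 1" n] m by (simp flip: of_nat_mult)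
    have pos: "real (n choose m) > 0" "real m > 0" "real n > 0" using m chp by auto
    have "(\<Sum>I\<in>P. (norm (\<Sum>i\<in>I. a i))\<^sup>2) / (real m)\<^sup>2 / real (n choose m)
        \<le> real ((n - 1) choose (m - 1)) * (\<Sum>i=1..n. (norm (a i))\<^sup>2) / (real m)\<^sup>2 / real (n choose m)"
      using sum_batches_norm_sq_le[of "{1..n}" a m] a0 m
      by (intro divide_right_mono) (auto simp: P_def)
    also have "real ((n - 1) choose (m - 1)) = real m * real (n choose m) / real n"
      using ch pos by (simp add: field_simps)
    also have "real m * real (n choose m) / real n * (\<Sum>i=1..n. (norm (a i))\<^sup>2) / (real m)\<^sup>2
          / real (n choose m) = (1 / real n) * (\<Sum>i=1..n. (norm (a i))\<^sup>2) / real m"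
      using pos by (simp add: field_simps power2_eq_square)
    finally show ?thesis unfolding eq if_P[OF True] by (rule ennreal_leI)
  next
    case False
    then have "m = n" using m by simp
    then have "P = {{1..n}}"
      using card_subset_eq[of "{1..n}"] by (auto simp: P_def)
    then show ?thesis unfolding eq using False a0 by simp
  qed
qed

lemma nn_integral_sample_single:
  assumes "n \<ge> 1"
  shows "(\<integral>\<^sup>+ I. \<phi> I \<partial>sample_batch n 1) = (\<Sum>i=1..n. \<phi> {i}) / of_nat n"
proof -
  have "{I. I \<subseteq> {1..n} \<and> card I = 1} = (\<lambda>i. {i}) ` {1..n}"
    by (auto simp: card_1_singleton_iff)
  then have "sample_batch n 1 = map_pmf (\<lambda>i. {i}) (pmf_of_set {1..n})"
    unfolding sample_batch_def using assms by (subst map_pmf_of_set_inj) auto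
  then show ?thesis using assms by (simp add: nn_integral_pmf_of_set)
qed

section \<open>Geometric stopping\<close>

text \<open>
  The probability of stopping at \<open>k\<close> is \<open>1 + p\<close> times that of stopping at \<open>k + 1\<close>. Weighting the
  recursion with these probabilities makes the terms in \<open>G\<close> telescope; what is left of them is
  \<open>p * G 0\<close> and a boundary term that is dropped because it is nonnegative. Working in
  \<^typ>\<open>ennreal\<close> avoids any summability assumption.
\<close>

lemma geometric_expectation_le_of_recursion:
  fixes G A :: "nat \<Rightarrow> ennreal" and p :: real and r :: ennreal
  assumes p: "p > 0"
    and step: "\<And>k. G (Suc k) + A k \<le> ennreal (1 + p) * G k + r"
  shows "(\<integral>\<^sup>+ k. A k \<partial>geometric_pmf (p / (1 + p))) \<le> ennreal p * G 0 + r"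
proof -
  define q where "q = geometric_pmf (p / (1 + p))"
  have q01: "p / (1 + p) \<in> {0<..1}" using p by auto
  have w: "pmf q k = (1 / (1 + p)) ^ k * (p / (1 + p))" for k
    using p q01 by (simp add: q_def field_simps)
  have w_Suc: "pmf q (Suc k) * (1 + p) = pmf q k" for k
    using p by (simp add: w)
  have partial: "ennreal (pmf q m * (1 + p)) * G m + (\<Sum>k<m. ennreal (pmf q k) * A k)
      \<le> ennreal p * G 0 + (\<Sum>k<m. ennreal (pmf q k)) * r" for m
  proof (induction m)
    case 0
    then show ?case using p by (simp add: w)
  next
    case (Suc m)
    have "ennreal (pmf q (Suc m) * (1 + p)) * G (Suc m) + (\<Sum>k<Suc m. ennreal (pmf q k) * A k)
        = ennreal (pmf q m) * (G (Suc m) + A m) + (\<Sum>k<m. ennreal (pmf q k) * A k)"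
      by (simp only: w_Suc sum.lessThan_Suc) (simp add: algebra_simps)
    also have "\<dots> \<le> ennreal (pmf q m) * (ennreal (1 + p) * G m + r)
        + (\<Sum>k<m. ennreal (pmf q k) * A k)"
      by (intro add_right_mono mult_left_mono step) auto
    also have "\<dots> = (ennreal (pmf q m * (1 + p)) * G m + (\<Sum>k<m. ennreal (pmf q k) * A k))
        + ennreal (pmf q m) * r"
      using p by (simp add: ennreal_mult' algebra_simps)
    also have "\<dots> \<le> (ennreal p * G 0 + (\<Sum>k<m. ennreal (pmf q k)) * r) + ennreal (pmf q m) * r"
      by (intro add_right_mono Suc.IH)
    also have "\<dots> = ennreal p * G 0 + (\<Sum>k<Suc m. ennreal (pmf q k)) * r"
      by (simp add: algebra_simps)
    finally show ?case .
  qed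
  have mass: "(\<Sum>k<m. ennreal (pmf q k)) \<le> 1" for m
  proof -
    have "(\<Sum>k<m. ennreal (pmf q k)) = ennreal (measure (measure_pmf q) {..<m})"
      by (simp add: measure_measure_pmf_finite)
    also have "\<dots> \<le> 1" by (simp add: measure_pmf.prob_le_1)
    finally show ?thesis .
  qed
  have "(\<Sum>k<m. ennreal (pmf q k) * A k) \<le> ennreal p * G 0 + r" for m
  proof -
    have "(\<Sum>k<m. ennreal (pmf q k) * A k)
        \<le> ennreal p * G 0 + (\<Sum>k<m. ennreal (pmf q k)) * r"
      by (rule order_trans[OF _ partial]) simp
    also have "\<dots> \<le> ennreal p * G 0 + 1 * r"
      by (intro add_left_mono mult_right_mono mass) auto
    finally show ?thesis by simp
  qed
  then have "(\<Sum>k. ennreal (pmf q k) * A k) \<le> ennreal p * G 0 + r"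
    by (intro suminf_le_const) auto
  then show ?thesis
    by (simp add: nn_integral_measure_pmf nn_integral_count_space_nat q_def)
qed

lemma Geom_eq_geometric_pmf: "B > 0 \<Longrightarrow> Geom (B / (B + 1)) = geometric_pmf ((1 / B) / (1 + 1 / B))"
  by (simp add: Geom_def field_simps)

lemma mean_Geom:
  assumes "B > 0"
  shows "(\<integral>\<^sup>+ N. ennreal (real N) \<partial>Geom (B / (B + 1))) = ennreal B"
proof -
  define q where "q = 1 - B / (B + 1)"
  have q: "q \<in> {0<..1}" "(1 - q) / q = B" using assms by (auto simp: q_def field_simps)
  have "(\<integral>\<^sup>+ N. ennreal (real N) \<partial>geometric_pmf q) = ennreal ((1 - q) / q)"
    using nn_integral_eq_integral[OF integrable_real_geometric_pmf[OF q(1)]]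
      expectation_geometric_pmf[OF q(1)] by simp
  then show ?thesis by (simp only: q(2)) (simp add: Geom_def q_def)
qed

section \<open>Gradients of smooth finite sums\<close>

lemma Rd_zero: "0 \<in> Rd d"
  by (simp add: Rd_def)

lemma Rd_sum: "(\<And>i. i \<in> A \<Longrightarrow> u i \<in> Rd d) \<Longrightarrow> (\<Sum>i\<in>A. u i) \<in> Rd d"
  by (induction A rule: infinite_finite_induct) (auto simp: Rd_zero Rd_add)

locale smooth_finite_sum =
  fixes d n :: nat and f :: "nat \<Rightarrow> rseq \<Rightarrow> real" and L :: real
  assumes n: "n \<ge> 1" and L: "L > 0"
    and differentiable: "\<And>i. i \<in> {1..n} \<Longrightarrow> f i differentiable_on Rd d"
    and smooth: "\<And>i x y. i \<in> {1..n} \<Longrightarrow> x \<in> Rd d \<Longrightarrow> y \<in> Rd d \<Longrightarrow>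
      norm (grad d (f i) x - grad d (f i) y) \<le> L * norm (x - y)"
    and bounded_below: "bdd_below (mean_fun n f ` Rd d)"
    and bounded_variance: "bdd_above (grad_variance d n f ` Rd d)"
begin

abbreviation grad_f :: "rseq \<Rightarrow> rseq"
  where "grad_f \<equiv> grad d (mean_fun n f)"

text \<open>
  \<^const>\<open>Delta_f\<close> is the initial suboptimality gap; the analysis uses the same gap at every iterate.
\<close>

abbreviation subopt :: "rseq \<Rightarrow> real"
  where "subopt \<equiv> Delta_f d n f"

text \<open>
  For \<open>B = n\<close> the anchor gradient is exact. Without this case distinction a large \<open>H\<^sup>*\<close> would
  make the bound useless there, because \<open>B\<close> may then be smaller than \<open>12 H\<^sup>* / \<epsilon>\<close>.
\<close>

abbreviation batch_error_bound :: "nat \<Rightarrow> real"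
  where "batch_error_bound B \<equiv> if B < n then H_star d n f / real B else 0"

lemma component_grad:
  assumes "i \<in> {1..n}" "x \<in> Rd d"
  shows "grad d (f i) x \<in> Rd d"
    and "(f i has_derivative inner (grad d (f i) x)) (at x within Rd d)"
proof -
  have "f i differentiable (at x within Rd d)"
    using differentiable[OF assms(1)] assms(2) by (simp add: differentiable_on_def)
  from grad_has_derivative[OF assms(2) this]
  show "grad d (f i) x \<in> Rd d"
    and "(f i has_derivative inner (grad d (f i) x)) (at x within Rd d)" by auto
qed

lemma mean_grad:
  assumes x: "x \<in> Rd d"
  shows "grad_f x = (1 / real n) *\<^sub>R (\<Sum>i=1..n. grad d (f i) x)"
    and "grad_f x \<in> Rd d"
    and "(mean_fun n f has_derivative inner (grad_f x)) (at x within Rd d)"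
proof -
  let ?g = "(1 / real n) *\<^sub>R (\<Sum>i=1..n. grad d (f i) x)"
  have g: "?g \<in> Rd d" by (intro Rd_scaleR Rd_sum component_grad x)
  have "((\<lambda>x. (1 / real n) * (\<Sum>i=1..n. f i x)) has_derivative
      (\<lambda>v. (1 / real n) * (\<Sum>i=1..n. inner (grad d (f i) x) v))) (at x within Rd d)"
    by (intro has_derivative_mult_right has_derivative_sum component_grad x) auto
  moreover have "(\<lambda>v. (1 / real n) * (\<Sum>i=1..n. inner (grad d (f i) x) v)) = inner ?g"
    by (simp add: fun_eq_iff inner_sum_left)
  ultimately have D: "(mean_fun n f has_derivative inner ?g) (at x within Rd d)"
    by (simp only: mean_fun_def[abs_def])
  show eq: "grad_f x = ?g" by (rule grad_eqI[OF x g D])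
  show "grad_f x \<in> Rd d" using eq g by simp
  show "(mean_fun n f has_derivative inner (grad_f x)) (at x within Rd d)" using eq D by simp
qed

lemma mean_grad_lipschitz:
  assumes x: "x \<in> Rd d" and y: "y \<in> Rd d"
  shows "norm (grad_f x - grad_f y) \<le> L * norm (x - y)"
proof -
  have "grad_f x - grad_f y = (1 / real n) *\<^sub>R (\<Sum>i=1..n. grad d (f i) x - grad d (f i) y)"
    by (simp add: mean_grad(1)[OF x] mean_grad(1)[OF y] sum_subtractf scaleR_diff_right)
  also have "norm \<dots> \<le> (1 / real n) * (\<Sum>i=1..n. L * norm (x - y))"
    unfolding norm_scaleR using n
    by (intro mult_mono order_trans[OF norm_sum] sum_mono smooth x y) auto
  also have "\<dots> = L * norm (x - y)" using n by simp
  finally show ?thesis .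
qed

text \<open>
  Along the segment from \<open>y\<close> to \<open>y + v\<close>, the difference \<open>\<phi>\<close> of the two sides has a nonpositive
  derivative by the Lipschitz bound for the gradient.
\<close>

lemma mean_descent:
  assumes y: "y \<in> Rd d" and v: "v \<in> Rd d"
  shows "mean_fun n f (y + v) \<le> mean_fun n f y + inner (grad_f y) v + L / 2 * (norm v)\<^sup>2"
proof -
  define \<phi> where "\<phi> = (\<lambda>t::real. mean_fun n f (y + t *\<^sub>R v)
    - t * inner (grad_f y) v - L / 2 * t\<^sup>2 * (norm v)\<^sup>2)"
  have "\<phi> 1 \<le> \<phi> 0"
  proof (rule DERIV_nonpos_imp_nonincreasing[where f = \<phi> and a = 0 and b = 1])
    fix t :: real assume t: "0 \<le> t" "t \<le> 1"
    let ?p = "\<lambda>t::real. y + t *\<^sub>R v"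
    have pt: "?p t \<in> Rd d" using y v by (intro Rd_add Rd_scaleR)
    have sub: "?p ` UNIV \<subseteq> Rd d" using y v by (auto intro: Rd_add Rd_scaleR)
    have "(?p has_derivative (\<lambda>s. s *\<^sub>R v)) (at t within UNIV)"
      by (auto intro!: derivative_eq_intros)
    from has_derivative_in_compose[OF this has_derivative_subset[OF mean_grad(3)[OF pt] sub]]
    have "((\<lambda>t. mean_fun n f (?p t)) has_real_derivative inner (grad_f (?p t)) v) (at t)"
      by (simp add: has_field_derivative_def mult_commute_abs)
    then have D: "(\<phi> has_real_derivative
        inner (grad_f (?p t)) v - inner (grad_f y) v - L * t * (norm v)\<^sup>2) (at t)"
      unfolding \<phi>_def by (auto intro!: derivative_eq_intros)
    have "inner (grad_f (?p t)) v - inner (grad_f y) v = inner (grad_f (?p t) - grad_f y) v"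
      by (simp add: inner_diff_left)
    also have "\<dots> \<le> norm (grad_f (?p t) - grad_f y) * norm v" by (rule norm_cauchy_schwarz)
    also have "\<dots> \<le> L * norm (?p t - y) * norm v"
      by (intro mult_right_mono mean_grad_lipschitz pt y) auto
    also have "\<dots> = L * t * (norm v)\<^sup>2" using t by (simp add: power2_eq_square)
    finally show "\<exists>D. DERIV \<phi> t :> D \<and> D \<le> 0" using D by force
  qed simp
  then show ?thesis by (simp add: \<phi>_def)
qed

lemma subopt_nonneg: "x \<in> Rd d \<Longrightarrow> 0 \<le> subopt x"
  using cINF_lower[OF bounded_below] by (simp add: Delta_f_def)

lemma grad_variance_le_H_star: "x \<in> Rd d \<Longrightarrow> grad_variance d n f x \<le> H_star d n f"
  unfolding H_star_def by (rule cSUP_upper[OF _ bounded_variance])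

lemma batch_grad_in_Rd: "I \<subseteq> {1..n} \<Longrightarrow> x \<in> Rd d \<Longrightarrow> batch_grad d f I x \<in> Rd d"
  unfolding batch_grad_def by (intro Rd_scaleR Rd_sum component_grad) auto

lemma batch_grad_error:
  assumes x: "x \<in> Rd d" and B: "1 \<le> B" "B \<le> n"
  shows "(\<integral>\<^sup>+ I. ennreal ((norm (batch_grad d f I x - grad_f x))\<^sup>2) \<partial>sample_batch n B)
    \<le> ennreal (batch_error_bound B)"
proof -
  define a where "a i = grad d (f i) x - grad_f x" for i
  have a0: "(\<Sum>i=1..n. a i) = 0"
    using n by (simp add: a_def sum_subtractf mean_grad(1)[OF x] sum_constant_scaleR)
  have "batch_grad d f I x - grad_f x = (1 / real B) *\<^sub>R (\<Sum>i\<in>I. a i)"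
    if "I \<in> set_pmf (sample_batch n B)" for I
    using that B
    by (auto simp: set_pmf_sample_batch[OF B(2)] batch_grad_def a_def sum_subtractf
        scaleR_diff_right sum_constant_scaleR)
  then have "(\<integral>\<^sup>+ I. ennreal ((norm (batch_grad d f I x - grad_f x))\<^sup>2) \<partial>sample_batch n B)
      = (\<integral>\<^sup>+ I. ennreal ((norm ((1 / real B) *\<^sub>R (\<Sum>i\<in>I. a i)))\<^sup>2) \<partial>sample_batch n B)"
    by (intro nn_integral_cong_AE AE_pmfI) simp
  also have "\<dots> \<le> ennreal (if B < n then (1 / real n) * (\<Sum>i=1..n. (norm (a i))\<^sup>2) / real B else 0)"
    by (rule mean_batch_norm_sq_le[OF a0 B])
  also have "\<dots> \<le> ennreal (batch_error_bound B)"
  proof -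
    have "(1 / real n) * (\<Sum>i=1..n. (norm (a i))\<^sup>2) \<le> H_star d n f"
      using grad_variance_le_H_star[OF x] by (simp only: grad_variance_def a_def)
    from divide_right_mono[OF this, of "real B"] show ?thesis by (auto intro!: ennreal_leI)
  qed
  finally show ?thesis .
qed

text \<open>
  The randomness of \<open>\<nu> i\<close> comes only from the difference of two gradients of the same component, and
  this difference is at most \<open>L\<close> times the distance of the two points. Its variance is at most its
  second moment, which is why the estimator becomes accurate close to the anchor point.
\<close>

lemma variance_reduced_second_moment:
  fixes g :: rseq
  assumes x: "x \<in> Rd d" and y: "y \<in> Rd d"
  defines "\<nu> \<equiv> \<lambda>i. grad d (f i) y - grad d (f i) x + g"
  shows "(1 / real n) *\<^sub>R (\<Sum>i=1..n. \<nu> i) = grad_f y + (g - grad_f x)"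
    and "(1 / real n) * (\<Sum>i=1..n. (norm (\<nu> i))\<^sup>2)
      \<le> L\<^sup>2 * (norm (y - x))\<^sup>2 + (norm (grad_f y + (g - grad_f x)))\<^sup>2"
proof -
  define \<zeta> where "\<zeta> i = grad d (f i) y - grad d (f i) x" for i
  define c where "c = grad_f y - grad_f x"
  have c: "c = (1 / real (card {1..n})) *\<^sub>R (\<Sum>i=1..n. \<zeta> i)"
    by (simp add: c_def \<zeta>_def mean_grad(1)[OF x] mean_grad(1)[OF y] sum_subtractf scaleR_diff_right)
  have \<nu>: "\<nu> i = \<zeta> i + g" for i by (simp add: \<nu>_def \<zeta>_def)
  show mean: "(1 / real n) *\<^sub>R (\<Sum>i=1..n. \<nu> i) = grad_f y + (g - grad_f x)"
    using n c by (simp add: \<nu> sum.distrib sum_constant_scaleR c_def algebra_simps)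
  have cg: "c + g = (1 / real (card {1..n})) *\<^sub>R (\<Sum>i=1..n. \<nu> i)"
    using mean by (simp add: c_def algebra_simps)
  have "(\<Sum>i=1..n. (norm (\<nu> i))\<^sup>2) - real n * (norm (c + g))\<^sup>2 = (\<Sum>i=1..n. (norm (\<zeta> i - c))\<^sup>2)"
    using sum_norm_diff_mean_sq[OF cg] n by (simp add: \<nu>)
  also have "\<dots> \<le> (\<Sum>i=1..n. (norm (\<zeta> i))\<^sup>2)"
    using sum_norm_diff_mean_sq[OF c] n by simp
  also have "\<dots> \<le> (\<Sum>i=1..n. (L * norm (y - x))\<^sup>2)"
    unfolding \<zeta>_def by (intro sum_mono power_mono smooth x y) auto
  also have "\<dots> = real n * (L\<^sup>2 * (norm (y - x))\<^sup>2)" by (simp add: power_mult_distrib)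
  finally have "(\<Sum>i=1..n. (norm (\<nu> i))\<^sup>2)
      \<le> real n * (L\<^sup>2 * (norm (y - x))\<^sup>2 + (norm (c + g))\<^sup>2)"
    by (simp add: algebra_simps)
  then show "(1 / real n) * (\<Sum>i=1..n. (norm (\<nu> i))\<^sup>2)
      \<le> L\<^sup>2 * (norm (y - x))\<^sup>2 + (norm (grad_f y + (g - grad_f x)))\<^sup>2"
    using n by (simp add: c_def field_simps add_diff_eq)
qed

end

section \<open>Expected descent of one epoch\<close>

text \<open>
  The arithmetic behind the inner step. In it \<open>u\<close>, \<open>D\<close>, \<open>E\<close> stand for the norms of the
  gradient, of the displacement from the anchor point and of the anchor error, \<open>q\<close> for the
  inner product of the first two vectors and \<open>V\<close> for the second moment of the direction. The
  assumptions on \<open>h * L\<close> make the part of \<open>V\<close> coming from \<open>D\<close> use up only a fraction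
  \<open>1/54\<close> of the available \<open>p\<^sup>2 * D\<^sup>2 / (2 * h)\<close>; the rest pays for \<open>q\<close>.
\<close>

lemma absorb_inner_step_errors:
  fixes h p L u D E q V :: real
  assumes h: "h > 0" and p: "p > 0" "p \<le> 1/8"
    and hL: "0 \<le> L" "h * L \<le> 1/24" "(h * L)\<^sup>2 * (h * L + p) \<le> p\<^sup>2 / 54"
    and q: "\<bar>q\<bar> \<le> u * D"
    and V: "V \<le> L\<^sup>2 * D\<^sup>2 + 2 * u\<^sup>2 + 2 * E\<^sup>2"
  shows "h * (h * L + p) / 2 * V \<le> 3/4 * h * u\<^sup>2 + p * q + p\<^sup>2 * D\<^sup>2 / (2 * h) + h * E\<^sup>2 / 2"
proof -
  have "h * (h * L + p) / 2 * V \<le> h * (h * L + p) / 2 * (L\<^sup>2 * D\<^sup>2 + 2 * u\<^sup>2 + 2 * E\<^sup>2)"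
    using h p hL by (intro mult_left_mono V) auto
  also have "\<dots> = (h * L)\<^sup>2 * (h * L + p) * (D\<^sup>2 / (2 * h)) + (h * L + p) * (h * u\<^sup>2)
      + (h * L + p) * (h * E\<^sup>2)"
    using h by (simp add: field_simps power2_eq_square)
  also have "\<dots> \<le> p\<^sup>2 / 54 * (D\<^sup>2 / (2 * h)) + 1/6 * (h * u\<^sup>2) + 1/6 * (h * E\<^sup>2)"
    using h p hL by (intro add_mono mult_right_mono) auto
  finally have 1: "h * (h * L + p) / 2 * V
      \<le> p\<^sup>2 / 54 * (D\<^sup>2 / (2 * h)) + 1/6 * (h * u\<^sup>2) + 1/6 * (h * E\<^sup>2)" .
  \<comment> \<open>Young's inequality with the budgets that are left: \<open>3/4 - 1/6 = 7/12\<close> for \<open>h * u\<^sup>2\<close> and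
    \<open>1 - 1/54 = 53/54\<close> for \<open>p\<^sup>2 * D\<^sup>2 / (2 * h)\<close>; it holds as \<open>3/7 \<le> 53/108\<close>.\<close>
  have "0 \<le> 7/12 * (h * u - 6/7 * (p * D))\<^sup>2 + (53/108 - 3/7) * (p * D)\<^sup>2" by simp
  then have "(h * u) * (p * D) \<le> 7/12 * (h * u)\<^sup>2 + 53/108 * (p * D)\<^sup>2"
    by (simp add: power2_eq_square algebra_simps)
  from divide_right_mono[OF this less_imp_le[OF h]]
  have 2: "u * (p * D) \<le> 7/12 * (h * u\<^sup>2) + 53/54 * (p\<^sup>2 * D\<^sup>2 / (2 * h))"
    using h by (simp add: field_simps power2_eq_square)
  have "p * \<bar>q\<bar> \<le> p * (u * D)" using p by (intro mult_left_mono q) auto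
  moreover have "- (p * \<bar>q\<bar>) \<le> p * q"
    using mult_left_mono[of "- \<bar>q\<bar>" q p] p by simp
  ultimately have 3: "- (p * q) \<le> u * (p * D)" by (simp add: mult.left_commute mult.commute)
  have 4: "0 \<le> h * E\<^sup>2" using h by simp
  from 1 2 3 4 show ?thesis by (simp add: algebra_simps)
qed

context smooth_finite_sum
begin

text \<open>
  Multiplied out, the square is a penalty for the distance to \<open>x\<close>, the linear term
  \<open>- inner e (y - x)\<close>, which offsets the bias of the inner steps, and a constant without which the
  other two could add up to a negative number.
\<close>

definition potential :: "real \<Rightarrow> real \<Rightarrow> rseq \<Rightarrow> rseq \<Rightarrow> rseq \<Rightarrow> real"
  where "potential h p x e y = subopt y + p / (2 * h) * (norm (y - (x + (h / p) *\<^sub>R e)))\<^sup>2"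

text \<open>
  By smoothness of \<open>f\<close> and expansion of the square, one step changes the potential by an inner
  product of \<open>\<nu> i\<close> with the fixed vector \<open>h *\<^sub>R G + p *\<^sub>R w\<close> and a multiple of
  \<open>(norm (\<nu> i))\<^sup>2\<close>, both of which average well. In the average, the inner product of \<open>e\<close> with the
  gradient has dropped out; its inner product with \<open>y - x\<close> cancels against the same term in \<open>p\<close>
  times the square in the potential.
\<close>

lemma potential_inner_step:
  fixes h p :: real
  assumes x: "x \<in> Rd d" and y: "y \<in> Rd d" and g: "g \<in> Rd d"
    and h: "h > 0" and p: "p > 0" "p \<le> 1/8"
    and hL: "h * L \<le> 1/24" "(h * L)\<^sup>2 * (h * L + p) \<le> p\<^sup>2 / 54"
  defines "e \<equiv> g - grad_f x"
  defines "\<nu> \<equiv> \<lambda>i. grad d (f i) y - grad d (f i) x + g"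
  shows "(1 / real n) * (\<Sum>i=1..n. potential h p x e (y - h *\<^sub>R \<nu> i))
      + (h / 4 * (norm (grad_f y))\<^sup>2 + p * subopt y)
    \<le> (1 + p) * potential h p x e y + h * (norm e)\<^sup>2"
proof -
  define G where "G = grad_f y"
  define \<delta> where "\<delta> = y - x"
  define w where "w = y - (x + (h / p) *\<^sub>R e)"
  define \<kappa> where "\<kappa> = h * (h * L + p) / 2"
  define V where "V = (1 / real n) * (\<Sum>i=1..n. (norm (\<nu> i))\<^sup>2)"
  have \<nu>R: "\<nu> i \<in> Rd d" if "i \<in> {1..n}" for i
    unfolding \<nu>_def using that x y g by (intro Rd_add Rd_diff component_grad)
  have step: "potential h p x e (y - h *\<^sub>R \<nu> i)
      \<le> potential h p x e y - inner (h *\<^sub>R G + p *\<^sub>R w) (\<nu> i) + \<kappa> * (norm (\<nu> i))\<^sup>2"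
    if i: "i \<in> {1..n}" for i
  proof -
    have "subopt (y - h *\<^sub>R \<nu> i) \<le> subopt y - h * inner G (\<nu> i) + L / 2 * h\<^sup>2 * (norm (\<nu> i))\<^sup>2"
      using mean_descent[OF y Rd_scaleR[OF \<nu>R[OF i], of "- h"]] h
      by (simp add: Delta_f_def G_def power_mult_distrib)
    moreover have "y - h *\<^sub>R \<nu> i - (x + (h / p) *\<^sub>R e) = w - h *\<^sub>R \<nu> i"
      by (simp add: w_def)
    then have "(norm (y - h *\<^sub>R \<nu> i - (x + (h / p) *\<^sub>R e)))\<^sup>2
        = (norm w)\<^sup>2 - 2 * h * inner w (\<nu> i) + h\<^sup>2 * (norm (\<nu> i))\<^sup>2"
      by (simp only:, simp add: power2_norm_eq_inner inner_diff_left inner_diff_right inner_commute,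
          simp add: power2_eq_square algebra_simps)
    ultimately have "potential h p x e (y - h *\<^sub>R \<nu> i)
        \<le> subopt y - h * inner G (\<nu> i) + L / 2 * h\<^sup>2 * (norm (\<nu> i))\<^sup>2
          + p / (2 * h) * ((norm w)\<^sup>2 - 2 * h * inner w (\<nu> i) + h\<^sup>2 * (norm (\<nu> i))\<^sup>2)"
      by (simp only: potential_def add_right_mono)
    also have "\<dots> = potential h p x e y - inner (h *\<^sub>R G + p *\<^sub>R w) (\<nu> i) + \<kappa> * (norm (\<nu> i))\<^sup>2"
      using h by (simp add: potential_def \<kappa>_def inner_add_left w_def[symmetric] field_simps
          power2_eq_square)
    finally show ?thesis .
  qed
  have "(1 / real n) * (\<Sum>i=1..n. potential h p x e (y - h *\<^sub>R \<nu> i))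
      \<le> (1 / real n) * (\<Sum>i=1..n. potential h p x e y - inner (h *\<^sub>R G + p *\<^sub>R w) (\<nu> i)
          + \<kappa> * (norm (\<nu> i))\<^sup>2)"
    by (intro mult_left_mono sum_mono step) auto
  also have "\<dots> = potential h p x e y
      - inner (h *\<^sub>R G + p *\<^sub>R w) ((1 / real n) *\<^sub>R (\<Sum>i=1..n. \<nu> i)) + \<kappa> * V"
    using n by (simp add: sum.distrib sum_subtractf inner_sum_right V_def sum_distrib_left
        algebra_simps flip: sum_divide_distrib)
  also have "(1 / real n) *\<^sub>R (\<Sum>i=1..n. \<nu> i) = G + e"
    unfolding \<nu>_def G_def e_def by (rule variance_reduced_second_moment(1)[OF x y])
  finally have 1: "(1 / real n) * (\<Sum>i=1..n. potential h p x e (y - h *\<^sub>R \<nu> i))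
      \<le> potential h p x e y - inner (h *\<^sub>R G + p *\<^sub>R w) (G + e) + \<kappa> * V" .
  have w: "p *\<^sub>R w = p *\<^sub>R \<delta> - h *\<^sub>R e"
    using p by (simp add: w_def \<delta>_def algebra_simps)
  have 2: "inner (h *\<^sub>R G + p *\<^sub>R w) (G + e)
      = h * (norm G)\<^sup>2 - h * (norm e)\<^sup>2 + p * inner G \<delta> + p * inner \<delta> e"
    unfolding w by (simp add: power2_norm_eq_inner inner_commute algebra_simps)
  have "p\<^sup>2 * (norm w)\<^sup>2 = (norm (p *\<^sub>R \<delta> - h *\<^sub>R e))\<^sup>2"
    unfolding w[symmetric] by (simp add: power_mult_distrib)
  also have "\<dots> = p\<^sup>2 * (norm \<delta>)\<^sup>2 - 2 * p * h * inner \<delta> e + h\<^sup>2 * (norm e)\<^sup>2"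
    by (simp add: power2_norm_eq_inner inner_diff_left inner_diff_right inner_commute,
          simp add: power2_eq_square algebra_simps)
  finally have 3: "p * (p / (2 * h) * (norm w)\<^sup>2)
      = p\<^sup>2 * (norm \<delta>)\<^sup>2 / (2 * h) - p * inner \<delta> e + h * (norm e)\<^sup>2 / 2"
    using h by (simp add: field_simps power2_eq_square)
  have "V \<le> L\<^sup>2 * (norm \<delta>)\<^sup>2 + (norm (G + e))\<^sup>2"
    unfolding V_def \<nu>_def \<delta>_def G_def e_def by (rule variance_reduced_second_moment(2)[OF x y])
  also have "(norm (G + e))\<^sup>2 \<le> 2 * (norm G)\<^sup>2 + 2 * (norm e)\<^sup>2"
    using zero_le_power2[of "norm (G - e)"]
    by (simp add: power2_norm_eq_inner inner_diff_left inner_diff_right inner_add_left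
        inner_add_right inner_commute)
  finally have "V \<le> L\<^sup>2 * (norm \<delta>)\<^sup>2 + 2 * (norm G)\<^sup>2 + 2 * (norm e)\<^sup>2" by simp
  from absorb_inner_step_errors[OF h p _ hL Cauchy_Schwarz_ineq2 this] L
  have 4: "\<kappa> * V \<le> 3/4 * h * (norm G)\<^sup>2 + p * inner G \<delta> + p\<^sup>2 * (norm \<delta>)\<^sup>2 / (2 * h)
      + h * (norm e)\<^sup>2 / 2"
    by (simp add: \<kappa>_def)
  have pot: "potential h p x e y = subopt y + p / (2 * h) * (norm w)\<^sup>2"
    by (simp add: potential_def w_def)
  have "(1 + p) * (a + b) = (a + b) + p * a + p * b" for a b :: real
    by (simp add: algebra_simps)
  then have "(1 + p) * potential h p x e y
      = potential h p x e y + p * subopt y + p * (p / (2 * h) * (norm w)\<^sup>2)"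
    unfolding pot .
  with 1 2 3 4 show ?thesis by (simp add: G_def)
qed

lemma inner_iter_in_Rd:
  assumes x: "x \<in> Rd d" and g: "g \<in> Rd d"
  shows "set_pmf (inner_iter d n f h 1 x g k) \<subseteq> Rd d"
proof (induction k)
  case (Suc k)
  have "I \<subseteq> {1..n}" if "I \<in> set_pmf (sample_batch n 1)" for I
    using that set_pmf_sample_batch[OF n] by auto
  with Suc x g show ?case
    by (auto simp: Let_def subset_iff intro!: Rd_diff Rd_add Rd_scaleR batch_grad_in_Rd)
qed (use x in simp)

text \<open>
  The inner steps satisfy the recursion of \<open>geometric_expectation_le_of_recursion\<close> with the expected
  potential as \<open>G\<close>. At the starting point the potential is
  \<open>subopt x + h / (2 * p) * (norm e)\<^sup>2\<close>, whence the factor \<open>3/2 = 1/2 + 1\<close>.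
\<close>

lemma epoch_descent_given_batch:
  fixes h p :: real
  assumes x: "x \<in> Rd d" and g: "g \<in> Rd d"
    and h: "h > 0" and p: "p > 0" "p \<le> 1/8"
    and hL: "h * L \<le> 1/24" "(h * L)\<^sup>2 * (h * L + p) \<le> p\<^sup>2 / 54"
  shows "(\<integral>\<^sup>+ N. \<integral>\<^sup>+ y. ennreal (h / 4 * (norm (grad_f y))\<^sup>2 + p * subopt y)
        \<partial>inner_iter d n f h 1 x g N \<partial>geometric_pmf (p / (1 + p)))
    \<le> ennreal (p * subopt x + 3/2 * h * (norm (g - grad_f x))\<^sup>2)"
proof -
  define e where "e = g - grad_f x"
  define G where "G k = (\<integral>\<^sup>+ y. ennreal (potential h p x e y) \<partial>inner_iter d n f h 1 x g k)" for k
  define A where "A k = (\<integral>\<^sup>+ y. ennreal (h / 4 * (norm (grad_f y))\<^sup>2 + p * subopt y)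
    \<partial>inner_iter d n f h 1 x g k)" for k
  have pot0: "0 \<le> potential h p x e y" if "y \<in> Rd d" for y
    using subopt_nonneg[OF that] h p by (simp add: potential_def)
  have "G (Suc k) + A k \<le> ennreal (1 + p) * G k + ennreal (h * (norm e)\<^sup>2)" for k
  proof -
    have "G (Suc k) + A k = (\<integral>\<^sup>+ y. (\<integral>\<^sup>+ I. ennreal (potential h p x e
          (y - h *\<^sub>R (batch_grad d f I y - batch_grad d f I x + g))) \<partial>sample_batch n 1)
        + ennreal (h / 4 * (norm (grad_f y))\<^sup>2 + p * subopt y) \<partial>inner_iter d n f h 1 x g k)"
      by (simp add: G_def A_def Let_def nn_integral_add)
    also have "\<dots> \<le> (\<integral>\<^sup>+ y. ennreal (1 + p) * ennreal (potential h p x e y)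
        + ennreal (h * (norm e)\<^sup>2) \<partial>inner_iter d n f h 1 x g k)"
    proof (intro nn_integral_mono_AE AE_pmfI)
      fix y assume "y \<in> set_pmf (inner_iter d n f h 1 x g k)"
      then have y: "y \<in> Rd d" using inner_iter_in_Rd[OF x g] by auto
      define \<nu> where "\<nu> i = grad d (f i) y - grad d (f i) x + g" for i
      have \<nu>R: "y - h *\<^sub>R \<nu> i \<in> Rd d" if "i \<in> {1..n}" for i
        unfolding \<nu>_def using that x y g by (intro Rd_scaleR Rd_add Rd_diff component_grad)
      have "(\<integral>\<^sup>+ I. ennreal (potential h p x e
          (y - h *\<^sub>R (batch_grad d f I y - batch_grad d f I x + g))) \<partial>sample_batch n 1)
          = (\<Sum>i=1..n. ennreal (potential h p x e (y - h *\<^sub>R \<nu> i))) / of_nat n"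
        by (simp add: nn_integral_sample_single[OF n, unfolded One_nat_def] batch_grad_def \<nu>_def)
      also have "\<dots> = ennreal ((1 / real n) * (\<Sum>i=1..n. potential h p x e (y - h *\<^sub>R \<nu> i)))"
      proof -
        have "0 \<le> (\<Sum>i=1..n. potential h p x e (y - h *\<^sub>R \<nu> i))"
          by (intro sum_nonneg pot0 \<nu>R)
        with n pot0[OF \<nu>R] show ?thesis
          by (subst sum_ennreal) (auto simp: ennreal_of_nat_eq_real_of_nat divide_ennreal)
      qed
      finally have "(\<integral>\<^sup>+ I. ennreal (potential h p x e
          (y - h *\<^sub>R (batch_grad d f I y - batch_grad d f I x + g))) \<partial>sample_batch n 1)
          + ennreal (h / 4 * (norm (grad_f y))\<^sup>2 + p * subopt y)
        = ennreal ((1 / real n) * (\<Sum>i=1..n. potential h p x e (y - h *\<^sub>R \<nu> i))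
          + (h / 4 * (norm (grad_f y))\<^sup>2 + p * subopt y))"
        using n pot0[OF \<nu>R] h p subopt_nonneg[OF y]
        by (simp only:, intro ennreal_plus[symmetric] mult_nonneg_nonneg add_nonneg_nonneg sum_nonneg)
          auto
      also have "\<dots> \<le> ennreal ((1 + p) * potential h p x e y + h * (norm e)\<^sup>2)"
        unfolding \<nu>_def e_def by (intro ennreal_leI potential_inner_step x y g h p hL)
      also have "\<dots> = ennreal (1 + p) * ennreal (potential h p x e y) + ennreal (h * (norm e)\<^sup>2)"
        using h p pot0[OF y] by (simp add: ennreal_mult)
      finally show "(\<integral>\<^sup>+ I. ennreal (potential h p x e
          (y - h *\<^sub>R (batch_grad d f I y - batch_grad d f I x + g))) \<partial>sample_batch n 1)
          + ennreal (h / 4 * (norm (grad_f y))\<^sup>2 + p * subopt y)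
        \<le> ennreal (1 + p) * ennreal (potential h p x e y) + ennreal (h * (norm e)\<^sup>2)" .
    qed
    also have "\<dots> = ennreal (1 + p) * G k + ennreal (h * (norm e)\<^sup>2)"
      by (simp add: G_def nn_integral_add nn_integral_cmult)
    finally show ?thesis .
  qed
  from geometric_expectation_le_of_recursion[where G = G and A = A and p = p, OF p(1) this]
  have "(\<integral>\<^sup>+ N. A N \<partial>geometric_pmf (p / (1 + p))) \<le> ennreal p * G 0 + ennreal (h * (norm e)\<^sup>2)" .
  also have "\<dots> = ennreal (p * potential h p x e x + h * (norm e)\<^sup>2)"
    using h p pot0[OF x] by (simp add: G_def ennreal_mult)
  also have "p * potential h p x e x + h * (norm e)\<^sup>2 = p * subopt x + 3/2 * h * (norm e)\<^sup>2"
    using h p by (simp add: potential_def power_mult_distrib power_divide field_simps power2_eq_square)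
  finally show ?thesis by (simp add: A_def e_def)
qed

end

section \<open>The whole run\<close>

text \<open>
  Every epoch is charged \<open>B\<close> for the batch and, because the number of inner steps has mean \<open>B\<close>,
  another \<open>B\<close> on average for the inner steps, whatever the starting point of the epoch is.
\<close>

lemma expected_cost_le:
  assumes "B > 0"
  shows "(\<integral>\<^sup>+ (xs, c). ennreal (real c) \<partial>scsg_run d n f x0 (\<lambda>_. h) (\<lambda>_. B) (\<lambda>_. 1) T)
    \<le> ennreal (2 * real B * real T)"
proof (induction T)
  case (Suc T)
  have cost: "(\<integral>\<^sup>+ z. ennreal (real (c + B + snd z)) \<partial>epoch d n f h B 1 x)
      = ennreal (real c) + ennreal (2 * real B)" for c x
  proof -
    have "(\<integral>\<^sup>+ z. ennreal (real (c + B + snd z)) \<partial>epoch d n f h B 1 x)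
        = (\<integral>\<^sup>+ N. ennreal (real (c + B + N)) \<partial>Geom (real B / (real B + 1)))"
      by (simp add: epoch_def Let_def measure_pmf.emeasure_space_1[simplified])
    also have "\<dots> = (\<integral>\<^sup>+ N. ennreal (real (c + B)) + ennreal (real N) \<partial>Geom (real B / (real B + 1)))"
      by (intro nn_integral_cong) (simp flip: ennreal_plus)
    also have "\<dots> = ennreal (real (c + B)) + ennreal (real B)"
      using assms by (simp add: nn_integral_add mean_Geom measure_pmf.emeasure_space_1[simplified])
    also have "\<dots> = ennreal (real c) + ennreal (2 * real B)"
      by (simp flip: ennreal_plus)
    finally show ?thesis .
  qed
  have "(\<integral>\<^sup>+ (xs, c). ennreal (real c) \<partial>scsg_run d n f x0 (\<lambda>_. h) (\<lambda>_. B) (\<lambda>_. 1) (Suc T))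
      = (\<integral>\<^sup>+ (xs, c). ennreal (real c) + ennreal (2 * real B)
          \<partial>scsg_run d n f x0 (\<lambda>_. h) (\<lambda>_. B) (\<lambda>_. 1) T)"
    by (simp add: split_def cost[simplified])
  also have "\<dots> = (\<integral>\<^sup>+ (xs, c). ennreal (real c) \<partial>scsg_run d n f x0 (\<lambda>_. h) (\<lambda>_. B) (\<lambda>_. 1) T)
      + ennreal (2 * real B)"
    by (simp add: split_def nn_integral_add measure_pmf.emeasure_space_1[simplified])
  also have "\<dots> \<le> ennreal (2 * real B * real T) + ennreal (2 * real B)"
    by (intro add_right_mono Suc.IH)
  also have "\<dots> = ennreal (2 * real B * real (Suc T))"
    by (simp add: algebra_simps flip: ennreal_plus)
  finally show ?case .
qed simp

lemma output_index_const:
  assumes "T \<ge> 1" "h > 0" "B > 0"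
  shows "output_index (\<lambda>_. h) (\<lambda>_. B) (\<lambda>_. 1) T = pmf_of_set {1..T}"
  using assms by (intro pmf_eqI) (auto simp: pmf_output_index indicator_def)

context smooth_finite_sum
begin

lemma H_star_nonneg: "0 \<le> H_star d n f"
proof -
  have "0 \<le> grad_variance d n f 0" by (simp add: grad_variance_def sum_nonneg)
  also have "\<dots> \<le> H_star d n f" by (rule grad_variance_le_H_star[OF Rd_zero])
  finally show ?thesis .
qed

lemma epoch_in_Rd:
  assumes x: "x \<in> Rd d" and B: "B \<le> n" and yN: "(y, N) \<in> set_pmf (epoch d n f h B 1 x)"
  shows "y \<in> Rd d"
proof -
  from yN obtain I where "I \<in> set_pmf (sample_batch n B)"
      "y \<in> set_pmf (inner_iter d n f h 1 x (batch_grad d f I x) N)"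
    by (auto simp: epoch_def Let_def)
  with B x show ?thesis
    using inner_iter_in_Rd[OF x batch_grad_in_Rd[OF _ x]] by (auto simp: set_pmf_sample_batch)
qed

text \<open>
  Averaging over the batch of the epoch replaces the squared anchor error by its variance bound.
\<close>

lemma epoch_descent:
  fixes h :: real and B :: nat
  defines "p \<equiv> 1 / real B"
  assumes x: "x \<in> Rd d" and B: "8 \<le> B" "B \<le> n" and h: "h > 0"
    and hL: "h * L \<le> 1/24" "(h * L)\<^sup>2 * (h * L + p) \<le> p\<^sup>2 / 54"
  shows "(\<integral>\<^sup>+ (y, N). ennreal (h / 4 * (norm (grad_f y))\<^sup>2 + p * subopt y) \<partial>epoch d n f h B 1 x)
    \<le> ennreal (p * subopt x + 3/2 * h * batch_error_bound B)"
proof -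
  have p: "p > 0" "p \<le> 1/8" using B by (auto simp: p_def field_simps)
  have sub0: "0 \<le> subopt x" by (rule subopt_nonneg[OF x])
  have Geom: "Geom (real B / (real B + 1)) = geometric_pmf (p / (1 + p))"
    unfolding p_def using B by (intro Geom_eq_geometric_pmf) simp
  have split: "ennreal (p * subopt x + 3/2 * h * r) = ennreal (p * subopt x) + ennreal (3/2 * h) * ennreal r"
    if r: "0 \<le> r" for r
  proof -
    have "0 \<le> p * subopt x" "0 \<le> 3/2 * h * r" "0 \<le> 3/2 * h" using p h sub0 r by simp_all
    then show ?thesis using r by (simp only: ennreal_plus ennreal_mult)
  qed
  have "(\<integral>\<^sup>+ (y, N). ennreal (h / 4 * (norm (grad_f y))\<^sup>2 + p * subopt y) \<partial>epoch d n f h B 1 x)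
      = (\<integral>\<^sup>+ I. \<integral>\<^sup>+ N. \<integral>\<^sup>+ y. ennreal (h / 4 * (norm (grad_f y))\<^sup>2 + p * subopt y)
          \<partial>inner_iter d n f h 1 x (batch_grad d f I x) N \<partial>geometric_pmf (p / (1 + p))
          \<partial>sample_batch n B)"
    by (simp add: epoch_def Let_def Geom)
  also have "\<dots> \<le> (\<integral>\<^sup>+ I. ennreal (p * subopt x)
      + ennreal (3/2 * h) * ennreal ((norm (batch_grad d f I x - grad_f x))\<^sup>2) \<partial>sample_batch n B)"
  proof (intro nn_integral_mono_AE AE_pmfI)
    fix I assume "I \<in> set_pmf (sample_batch n B)"
    then have "batch_grad d f I x \<in> Rd d"
      using B x by (intro batch_grad_in_Rd) (auto simp: set_pmf_sample_batch)
    from epoch_descent_given_batch[OF x this h p hL]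
    show "(\<integral>\<^sup>+ N. \<integral>\<^sup>+ y. ennreal (h / 4 * (norm (grad_f y))\<^sup>2 + p * subopt y)
          \<partial>inner_iter d n f h 1 x (batch_grad d f I x) N \<partial>geometric_pmf (p / (1 + p)))
      \<le> ennreal (p * subopt x)
        + ennreal (3/2 * h) * ennreal ((norm (batch_grad d f I x - grad_f x))\<^sup>2)"
      by (simp only: split[OF zero_le_power2])
  qed
  also have "\<dots> = ennreal (p * subopt x) + ennreal (3/2 * h)
      * (\<integral>\<^sup>+ I. ennreal ((norm (batch_grad d f I x - grad_f x))\<^sup>2) \<partial>sample_batch n B)"
    by (simp add: nn_integral_add nn_integral_cmult measure_pmf.emeasure_space_1[simplified])
  also have "\<dots> \<le> ennreal (p * subopt x) + ennreal (3/2 * h) * ennreal (batch_error_bound B)"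
    using B by (intro add_left_mono mult_left_mono batch_grad_error x) auto
  also have "\<dots> = ennreal (p * subopt x + 3/2 * h * batch_error_bound B)"
    using H_star_nonneg by (intro split[symmetric]) simp
  finally show ?thesis .
qed

lemma scsg_run_support:
  assumes x0: "x0 \<in> Rd d" and B: "B \<le> n"
    and "(xs, c) \<in> set_pmf (scsg_run d n f x0 (\<lambda>_. h) (\<lambda>_. B) (\<lambda>_. 1) T)"
  shows "length xs = Suc T \<and> set xs \<subseteq> Rd d"
  using assms(3)
proof (induction T arbitrary: xs c)
  case 0
  then show ?case using x0 by simp
next
  case (Suc T)
  from Suc.prems obtain ys c' y N where
      ys: "(ys, c') \<in> set_pmf (scsg_run d n f x0 (\<lambda>_. h) (\<lambda>_. B) (\<lambda>_. 1) T)"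
      and y: "(y, N) \<in> set_pmf (epoch d n f h B 1 (last ys))" and xs: "xs = ys @ [y]"
    by auto
  from Suc.IH[OF ys] have "length ys = Suc T" "set ys \<subseteq> Rd d" by auto
  moreover from this have "last ys \<in> Rd d" by (metis last_in_set length_0_conv nat.distinct(1) subsetD)
  ultimately show ?case using epoch_in_Rd[OF _ B y] xs by auto
qed

text \<open>
  The term \<open>p * subopt\<close> at the end of one epoch pays for the start of the next, so the epoch
  inequalities telescope along the run.
\<close>

lemma run_descent:
  fixes h :: real and B :: nat
  defines "p \<equiv> 1 / real B"
  assumes x0: "x0 \<in> Rd d" and B: "8 \<le> B" "B \<le> n" and h: "h > 0"
    and hL: "h * L \<le> 1/24" "(h * L)\<^sup>2 * (h * L + p) \<le> p\<^sup>2 / 54"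
  shows "(\<integral>\<^sup>+ (xs, c). ennreal ((\<Sum>j=1..T. h / 4 * (norm (grad_f (xs ! j)))\<^sup>2) + p * subopt (last xs))
      \<partial>scsg_run d n f x0 (\<lambda>_. h) (\<lambda>_. B) (\<lambda>_. 1) T)
    \<le> ennreal (p * subopt x0 + real T * (3/2 * h * batch_error_bound B))"
proof (induction T)
  case (Suc T)
  let ?V = "3/2 * h * batch_error_bound B"
  let ?S = "\<lambda>T xs. \<Sum>j=1..T. h / 4 * (norm (grad_f (xs ! j)))\<^sup>2"
  let ?run = "scsg_run d n f x0 (\<lambda>_. h) (\<lambda>_. B) (\<lambda>_. 1)"
  have p0: "p > 0" using B by (simp add: p_def)
  have V0: "0 \<le> ?V" using h H_star_nonneg by simp
  have S0: "0 \<le> ?S T xs" for T xs using h by (intro sum_nonneg) simp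
  have "(\<integral>\<^sup>+ (xs, c). ennreal (?S (Suc T) xs + p * subopt (last xs)) \<partial>?run (Suc T))
      = (\<integral>\<^sup>+ (xs, c). \<integral>\<^sup>+ (y, N). ennreal (?S (Suc T) (xs @ [y]) + p * subopt y)
          \<partial>epoch d n f h B 1 (last xs) \<partial>?run T)"
    by (simp add: split_def del: sum.cl_ivl_Suc)
  also have "\<dots> \<le> (\<integral>\<^sup>+ (xs, c). ennreal (?S T xs + p * subopt (last xs)) + ennreal ?V \<partial>?run T)"
  proof (intro nn_integral_mono_AE AE_pmfI, clarify)
    fix xs c assume "(xs, c) \<in> set_pmf (?run T)"
    from scsg_run_support[OF x0 B(2) this]
    have len: "length xs = Suc T" and R: "set xs \<subseteq> Rd d" by auto
    then have "xs \<noteq> []" by auto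
    with R have last: "last xs \<in> Rd d" by auto
    have split: "?S (Suc T) (xs @ [y]) = ?S T xs + h / 4 * (norm (grad_f y))\<^sup>2" for y
      using len by (simp add: nth_append)
    have "(\<integral>\<^sup>+ (y, N). ennreal (?S (Suc T) (xs @ [y]) + p * subopt y) \<partial>epoch d n f h B 1 (last xs))
        = (\<integral>\<^sup>+ (y, N). ennreal (?S T xs)
            + ennreal (h / 4 * (norm (grad_f y))\<^sup>2 + p * subopt y) \<partial>epoch d n f h B 1 (last xs))"
    proof (intro nn_integral_cong_AE AE_pmfI, clarify)
      fix y N assume "(y, N) \<in> set_pmf (epoch d n f h B 1 (last xs))"
      from subopt_nonneg[OF epoch_in_Rd[OF last B(2) this]]
      show "ennreal (?S (Suc T) (xs @ [y]) + p * subopt y)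
          = ennreal (?S T xs) + ennreal (h / 4 * (norm (grad_f y))\<^sup>2 + p * subopt y)"
        unfolding split using S0[of xs T] h p0 by (subst ennreal_plus[symmetric]) (auto simp: add.assoc)
    qed
    also have "\<dots> = ennreal (?S T xs)
        + (\<integral>\<^sup>+ (y, N). ennreal (h / 4 * (norm (grad_f y))\<^sup>2 + p * subopt y)
            \<partial>epoch d n f h B 1 (last xs))"
      by (simp add: split_def nn_integral_add measure_pmf.emeasure_space_1[simplified])
    also have "\<dots> \<le> ennreal (?S T xs) + ennreal (p * subopt (last xs) + ?V)"
      unfolding p_def by (intro add_left_mono epoch_descent last B h hL[unfolded p_def])
    also have "\<dots> = ennreal (?S T xs + p * subopt (last xs)) + ennreal ?V"
      using S0[of xs T] p0 V0 subopt_nonneg[OF last] by (simp add: ennreal_plus add.assoc)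
    finally show "(\<integral>\<^sup>+ (y, N). ennreal (?S (Suc T) (xs @ [y]) + p * subopt y)
          \<partial>epoch d n f h B 1 (last xs))
      \<le> ennreal (?S T xs + p * subopt (last xs)) + ennreal ?V" .
  qed
  also have "\<dots> = (\<integral>\<^sup>+ (xs, c). ennreal (?S T xs + p * subopt (last xs)) \<partial>?run T) + ennreal ?V"
    by (simp add: split_def nn_integral_add measure_pmf.emeasure_space_1[simplified])
  also have "\<dots> \<le> ennreal (p * subopt x0 + real T * ?V) + ennreal ?V"
    by (intro add_right_mono Suc.IH)
  also have "\<dots> = ennreal (p * subopt x0 + real (Suc T) * ?V)"
  proof -
    have plus: "ennreal (a + real T * v) + ennreal v = ennreal (a + real (Suc T) * v)"
      if "0 \<le> a" "0 \<le> v" for a v :: real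
      using that by (subst ennreal_plus[symmetric]) (auto simp: algebra_simps)
    show ?thesis using p0 V0 subopt_nonneg[OF x0] by (intro plus) simp_all
  qed
  finally show ?case .
qed simp

text \<open>
  For constant parameters the output is one of the \<open>T\<close> epoch end points, chosen uniformly, so its mean
  squared gradient is the average of those bounded in \<open>run_descent\<close>.
\<close>

lemma mean_sq_grad_le:
  fixes h :: real and B :: nat
  defines "p \<equiv> 1 / real B"
  assumes x0: "x0 \<in> Rd d" and B: "8 \<le> B" "B \<le> n" and h: "h > 0"
    and hL: "h * L \<le> 1/24" "(h * L)\<^sup>2 * (h * L + p) \<le> p\<^sup>2 / 54" and T: "T \<ge> 1"
  shows "mean_sq_grad d n f x0 (\<lambda>_. h) (\<lambda>_. B) (\<lambda>_. 1) T
    \<le> ennreal (4 * p * subopt x0 / (h * real T) + 6 * batch_error_bound B)"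
proof -
  let ?run = "scsg_run d n f x0 (\<lambda>_. h) (\<lambda>_. B) (\<lambda>_. 1) T"
  let ?S = "\<lambda>xs. \<Sum>j=1..T. h / 4 * (norm (grad_f (xs ! j)))\<^sup>2"
  have p0: "p > 0" using B by (simp add: p_def)
  have T0: "real T > 0" using T by simp
  have "mean_sq_grad d n f x0 (\<lambda>_. h) (\<lambda>_. B) (\<lambda>_. 1) T
      = (\<integral>\<^sup>+ (xs, c). (\<Sum>j=1..T. ennreal ((norm (grad_f (xs ! j)))\<^sup>2)) / of_nat T \<partial>?run)"
    using T B h by (simp add: mean_sq_grad_def scsg_output_def output_index_const[simplified] split_def
        nn_integral_pmf_of_set)
  also have "\<dots> \<le> (\<integral>\<^sup>+ (xs, c). ennreal (4 / (h * real T))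
      * ennreal (?S xs + p * subopt (last xs)) \<partial>?run)"
  proof (intro nn_integral_mono_AE AE_pmfI, clarify)
    fix xs c assume "(xs, c) \<in> set_pmf ?run"
    from scsg_run_support[OF x0 B(2) this]
    have len: "length xs = Suc T" and R: "set xs \<subseteq> Rd d" by auto
    then have "xs \<noteq> []" by auto
    with R have last: "0 \<le> subopt (last xs)" by (intro subopt_nonneg) auto
    have "(\<Sum>j=1..T. ennreal ((norm (grad_f (xs ! j)))\<^sup>2)) / of_nat T
        = ennreal ((\<Sum>j=1..T. (norm (grad_f (xs ! j)))\<^sup>2) / real T)"
      using T0 by (simp add: ennreal_of_nat_eq_real_of_nat divide_ennreal sum_nonneg)
    also have "(\<Sum>j=1..T. (norm (grad_f (xs ! j)))\<^sup>2) / real T = 4 / (h * real T) * ?S xs"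
    proof -
      have S: "?S xs = h / 4 * (\<Sum>j=1..T. (norm (grad_f (xs ! j)))\<^sup>2)"
        by (simp only: sum_distrib_left)
      show ?thesis unfolding S using h by simp
    qed
    also have "ennreal \<dots> \<le> ennreal (4 / (h * real T) * (?S xs + p * subopt (last xs)))"
      using h p0 last by (intro ennreal_leI mult_left_mono) auto
    also have "\<dots> = ennreal (4 / (h * real T)) * ennreal (?S xs + p * subopt (last xs))"
      using h by (intro ennreal_mult') simp
    finally show "(\<Sum>j=1..T. ennreal ((norm (grad_f (xs ! j)))\<^sup>2)) / of_nat T
      \<le> ennreal (4 / (h * real T)) * ennreal (?S xs + p * subopt (last xs))" .
  qed
  also have "\<dots> = ennreal (4 / (h * real T))
      * (\<integral>\<^sup>+ (xs, c). ennreal (?S xs + p * subopt (last xs)) \<partial>?run)"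
    by (simp add: split_def nn_integral_cmult)
  also have "\<dots> \<le> ennreal (4 / (h * real T))
      * ennreal (p * subopt x0 + real T * (3/2 * h * batch_error_bound B))"
    unfolding p_def by (intro mult_left_mono run_descent x0 B h hL[unfolded p_def]) auto
  also have "\<dots> = ennreal (4 / (h * real T) * (p * subopt x0 + real T * (3/2 * h * batch_error_bound B)))"
    using h by (intro ennreal_mult'[symmetric]) simp
  also have "4 / (h * real T) * (p * subopt x0 + real T * (3/2 * h * batch_error_bound B))
      = 4 * p * subopt x0 / (h * real T) + 6 * batch_error_bound B"
    using h T0 by (simp add: field_simps)
  finally show ?thesis .
qed

end

section \<open>Complexity\<close>

theorem corollary3p3:
  shows "\<exists>K::real. K > 0 \<and>
    (\<forall>(d::nat) (n::nat) (f :: nat \<Rightarrow> rseq \<Rightarrow> real) (L::real) (x0::rseq) (\<epsilon>::real)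
      (B::nat) (\<eta>::real).
        d \<ge> 1 \<longrightarrow> n \<ge> 1 \<longrightarrow> L > 0 \<longrightarrow> \<epsilon> > 0 \<longrightarrow> x0 \<in> Rd d \<longrightarrow>
        (\<forall>i\<in>{1..n}. f i differentiable_on Rd d) \<longrightarrow>
        (\<forall>i\<in>{1..n}. \<forall>x\<in>Rd d. \<forall>y\<in>Rd d.
           norm (grad d (f i) x - grad d (f i) y) \<le> L * norm (x - y)) \<longrightarrow>
        bdd_below (mean_fun n f ` Rd d) \<longrightarrow>
        bdd_above (grad_variance d n f ` Rd d) \<longrightarrow>
        B = nat \<lceil>min (12 * H_star d n f / \<epsilon>) (real n)\<rceil> \<longrightarrow>
        B \<ge> 8 \<longrightarrow>
        \<eta> = 1 / (6 * L * real B powr (2/3)) \<longrightarrow>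
        expected_C_comp d n f x0 (\<lambda>_. \<eta>) (\<lambda>_. B) (\<lambda>_. 1) \<epsilon>
          \<le> ennreal (K * (min (H_star d n f / \<epsilon>) (real n)
               + L * Delta_f d n f x0 / \<epsilon> * min (H_star d n f / \<epsilon>) (real n) powr (2/3))))"
proof (intro exI[of _ 1344] conjI allI impI)
  fix d n B :: nat and f :: "nat \<Rightarrow> rseq \<Rightarrow> real" and L \<epsilon> \<eta> :: real and x0 :: rseq
  assume n: "n \<ge> 1" and L: "L > 0" and \<epsilon>: "\<epsilon> > 0" and x0: "x0 \<in> Rd d"
    and diff: "\<forall>i\<in>{1..n}. f i differentiable_on Rd d"
    and lip: "\<forall>i\<in>{1..n}. \<forall>x\<in>Rd d. \<forall>y\<in>Rd d.
      norm (grad d (f i) x - grad d (f i) y) \<le> L * norm (x - y)"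
    and bdd: "bdd_below (mean_fun n f ` Rd d)" "bdd_above (grad_variance d n f ` Rd d)"
    and B_def: "B = nat \<lceil>min (12 * H_star d n f / \<epsilon>) (real n)\<rceil>" and B8: "B \<ge> 8"
    and \<eta>: "\<eta> = 1 / (6 * L * real B powr (2/3))"
  interpret smooth_finite_sum d n f L
    using n L diff lip bdd by unfold_locales auto
  define H where "H = H_star d n f"
  define \<Delta> where "\<Delta> = Delta_f d n f x0"
  define m where "m = min (H / \<epsilon>) (real n)"
  define s where "s = real B powr (1/3)"
  have \<Delta>0: "0 \<le> \<Delta>" unfolding \<Delta>_def by (rule subopt_nonneg[OF x0])
  have H0: "0 \<le> H" unfolding H_def by (rule H_star_nonneg)
  have m0: "0 \<le> m" using H0 \<epsilon> by (simp add: m_def)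

  have B_ceil: "real B = of_int \<lceil>min (12 * H / \<epsilon>) (real n)\<rceil>"
    using B8 B_def by (simp add: H_def)
  have Bn: "B \<le> n"
  proof -
    have "\<lceil>min (12 * H / \<epsilon>) (real n)\<rceil> \<le> int n" by (simp add: ceiling_le_iff)
    then show ?thesis using B_def by (simp add: H_def)
  qed
  \<comment> \<open>Rounding up costs a factor of at most \<open>8/7\<close>, as a batch size of at least \<open>8\<close> means that the
    unrounded value exceeds \<open>7\<close>; and \<open>12 * 8/7 \<le> 14\<close>.\<close>
  have B_upper: "real B \<le> 14 * m"
  proof -
    have "real B < min (12 * H / \<epsilon>) (real n) + 1" unfolding B_ceil by linarith
    moreover have "min (12 * H / \<epsilon>) (real n) \<le> 12 * m"
      using H0 \<epsilon> by (auto simp: m_def min_def)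
    moreover have "8 \<le> real B" using B8 by simp
    ultimately show ?thesis by linarith
  qed
  have V: "6 * batch_error_bound B \<le> \<epsilon> / 2"
  proof (cases "B < n")
    case True
    have "min (12 * H / \<epsilon>) (real n) \<le> real B" unfolding B_ceil by (rule le_of_int_ceiling)
    with True have "12 * H / \<epsilon> \<le> real B" by (auto simp: min_def split: if_splits)
    then have "H / real B \<le> \<epsilon> / 12" using \<epsilon> B8 by (simp add: field_simps)
    then have "6 * (H / real B) \<le> \<epsilon> / 2" by linarith
    then show ?thesis unfolding if_P[OF True] H_def .
  qed (use \<epsilon> in simp)

  have B0: "real B > 0" using B8 by simp
  have s3: "real B = s ^ 3" using B0 by (simp add: s_def powr_powr flip: powr_realpow)
  have s2: "real B powr (2/3) = s\<^sup>2" using B0 by (simp add: s_def powr_powr flip: powr_realpow)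
  have s_ge: "s \<ge> 2"
  proof (rule ccontr)
    assume "\<not> 2 \<le> s"
    then have "s ^ 3 < 2 ^ 3" using B0 by (intro power_strict_mono) (auto simp: s_def)
    then show False using B8 s3 by simp
  qed
  have \<eta>0: "\<eta> > 0" using L B0 by (simp add: \<eta>)
  have \<eta>L: "\<eta> * L = 1 / (6 * s\<^sup>2)" using L by (simp add: \<eta> s2)
  \<comment> \<open>Both conditions on the step size are tightest, and hold with equality, for \<open>s = 2\<close>, that is for
    the smallest admissible \<open>B\<close>; this is where \<open>1/24\<close> and \<open>1/54\<close> come from.\<close>
  have hL1: "\<eta> * L \<le> 1/24"
  proof -
    have "2\<^sup>2 \<le> s\<^sup>2" using s_ge by (intro power_mono) auto
    then show ?thesis unfolding \<eta>L using s_ge by (simp add: field_simps)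
  qed
  have hL2: "(\<eta> * L)\<^sup>2 * (\<eta> * L + 1 / real B) \<le> (1 / real B)\<^sup>2 / 54"
  proof -
    have "(\<eta> * L)\<^sup>2 * (\<eta> * L + 1 / real B) = (1 / s ^ 6) * (1/36 * (1/6 + 1 / s))"
      unfolding \<eta>L s3 using s_ge by (simp add: field_simps power2_eq_square eval_nat_numeral)
    also have "\<dots> \<le> (1 / s ^ 6) * (1/54)"
      using s_ge by (intro mult_left_mono) (auto simp: field_simps)
    also have "\<dots> = (1 / real B)\<^sup>2 / 54"
      unfolding s3 by (simp add: power_divide flip: power_mult)
    finally show ?thesis .
  qed

  \<comment> \<open>\<open>z\<close> is the number of epochs after which the optimization error is at most \<open>\<epsilon> / 2\<close>. The added
    epoch in \<open>T0\<close> rounds \<open>z\<close> up and ensures that there is at least one.\<close>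
  define z where "z = 48 * L * \<Delta> / (\<epsilon> * s)"
  have z0: "0 \<le> z" using L \<Delta>0 \<epsilon> s_ge by (simp add: z_def)
  define T0 where "T0 = nat \<lfloor>z\<rfloor> + 1"
  have T0: "z \<le> real T0" "real T0 \<le> z + 1" using z0 unfolding T0_def by linarith+
  have "mean_sq_grad d n f x0 (\<lambda>_. \<eta>) (\<lambda>_. B) (\<lambda>_. 1) T \<le> ennreal \<epsilon>" if T: "T \<ge> T0" for T
  proof -
    have T1: "T \<ge> 1" using T by (simp add: T0_def)
    have "4 * (1 / real B) * \<Delta> / (\<eta> * real T) = z * \<epsilon> / (2 * real T)"
      unfolding \<eta> s2 z_def using s_ge \<epsilon> L T1 s3 by (simp add: field_simps power2_eq_square eval_nat_numeral)
    also have "\<dots> \<le> real T * \<epsilon> / (2 * real T)"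
      using T0(1) T \<epsilon> by (intro divide_right_mono mult_right_mono) auto
    also have "\<dots> = \<epsilon> / 2" using T1 by simp
    finally have "4 * (1 / real B) * \<Delta> / (\<eta> * real T) + 6 * batch_error_bound B \<le> \<epsilon>"
      using V by linarith
    then show ?thesis
      by (intro order_trans[OF mean_sq_grad_le[OF x0 B8 Bn \<eta>0 hL1 hL2 T1]] ennreal_leI)
        (simp only: \<Delta>_def)
  qed
  then have "epochs_needed d n f x0 (\<lambda>_. \<eta>) (\<lambda>_. B) (\<lambda>_. 1) \<epsilon> \<le> enat T0"
    unfolding epochs_needed_def by (intro Inf_lower) (auto simp: T0_def)
  then obtain T where T: "epochs_needed d n f x0 (\<lambda>_. \<eta>) (\<lambda>_. B) (\<lambda>_. 1) \<epsilon> = enat T" "T \<le> T0"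
    by (cases "epochs_needed d n f x0 (\<lambda>_. \<eta>) (\<lambda>_. B) (\<lambda>_. 1) \<epsilon>") auto

  have "expected_C_comp d n f x0 (\<lambda>_. \<eta>) (\<lambda>_. B) (\<lambda>_. 1) \<epsilon> \<le> ennreal (2 * real B * real T)"
    using B8 T(1) by (simp add: expected_C_comp_def expected_cost_le[simplified])
  also have "\<dots> \<le> ennreal (2 * real B * (z + 1))"
    using T(2) T0(2) by (intro ennreal_leI mult_left_mono) auto
  also have "\<dots> \<le> ennreal (1344 * (m + L * \<Delta> / \<epsilon> * m powr (2/3)))"
  proof (rule ennreal_leI)
    have "real B powr (2/3) \<le> (14 * m) powr (2/3)"
      using B_upper by (intro powr_mono2) auto
    also have "\<dots> = 14 powr (2/3) * m powr (2/3)" using m0 by (intro powr_mult)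
    also have "\<dots> \<le> 14 powr 1 * m powr (2/3)" by (intro mult_right_mono powr_mono) auto
    finally have B23: "s\<^sup>2 \<le> 14 * m powr (2/3)" by (simp add: s2)
    have "2 * real B * (z + 1) = 2 * real B + 96 * (L * \<Delta> / \<epsilon>) * s\<^sup>2"
      unfolding z_def s3 using s_ge \<epsilon> by (simp add: field_simps power2_eq_square eval_nat_numeral)
    also have "\<dots> \<le> 2 * (14 * m) + 96 * (L * \<Delta> / \<epsilon>) * (14 * m powr (2/3))"
      using L \<Delta>0 \<epsilon> by (intro add_mono mult_left_mono B_upper B23) auto
    also have "\<dots> \<le> 1344 * (m + L * \<Delta> / \<epsilon> * m powr (2/3))"
      using m0 by (simp add: algebra_simps)
    finally show "2 * real B * (z + 1) \<le> 1344 * (m + L * \<Delta> / \<epsilon> * m powr (2/3))" .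
  qed
  finally show "expected_C_comp d n f x0 (\<lambda>_. \<eta>) (\<lambda>_. B) (\<lambda>_. 1) \<epsilon>
      \<le> ennreal (1344 * (min (H_star d n f / \<epsilon>) (real n)
        + L * Delta_f d n f x0 / \<epsilon> * min (H_star d n f / \<epsilon>) (real n) powr (2/3)))"
    by (simp only: m_def H_def \<Delta>_def)
qed simp

end
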